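(* For $k\in\mathbb{N}$, we have $$g_k(\tau)=-\frac{\delta_{k,1}}2+\sum_{n\ge1}\sum_{m=1}^{n}a_{n,m}\,m^{k-1}q^n\qquad\text{and}\qquad T_0(\tau)=2iq^{\frac18}\exp\left(-\sum_{n\ge1}\sum_{m=1}^{n}\frac{a_{n,m}}{m}q^n\right).$$ Here $a_{n,m}\in\mathbb{Z}$, and $a_{n,m}=0$ if $m<\left\lceil\frac12\left(\sqrt{8n+1}-1\right)\right\rceil$. In fact, we have $$a_{n,m}:=\sum_{\lambda\in\Lambda(n,m)}(-1)^{m+m_1}\frac{m}{m_1}\binom{m_1}{m_1-m_2,\;m_2-m_3,\;\ldots}.$$
   Context: $\mathbb{N}=\{1,2,\dots\}$, $\tau$ lies in the complex upper half-plane, $z\in\mathbb{C}$, $q:=e^{2\pi i\tau}$, $\zeta:=e^{2\pi i z}$, with $q^{r}:=e^{2\pi i r\tau}$ and $\zeta^{r}:=e^{2\pi i r z}$ for $r\in\mathbb{Q}$. $\delta_{j,\ell}$ is the Kronecker delta. A partition $\lambda$ of $n$ is written $\lambda=(1^{m_1},2^{m_2},\dots,n^{m_n})\vdash n$, where $m_j$ is the multiplicity of $j$ (and $m_j=0$ for $j>n$); its length is $\ell(\lambda):=\sum_{j=1}^n m_j$. Put $$\Lambda(n,m):=\{\lambda\vdash n:\ m_1\ge m_2\ge\cdots\ge m_n\ge0,\ \ell(\lambda)=m\}.$$ $\binom{N}{a_1,a_2,\ldots}=\frac{N!}{a_1!a_2!\cdots}$ (with $\sum_j a_j=N$) is the multinomial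 coefficient. Partial theta function: $T(z;\tau):=2i\sum_{n\ge0}(-1)^n\zeta^{n+\frac12}q^{\frac12(n+\frac12)^2}$ and $T_0(\tau):=T(0;\tau)$. The partial Eisenstein series $g_k$, $k\in\mathbb{N}$, are defined by the identity $$T(z;\tau)=T_0(\tau)\exp\left(-\sum_{k\ge1}g_k(\tau)\frac{(2\pi i z)^k}{k!}\right).$$
   Formalization: The expansions are proved for τ such that T_0 has no zero τ' with Im τ' ≥ Im τ (this includes some half-plane Im τ ≥ Y), not for all τ: T_0 has zeros (|q| about 0.77), where g_k is undefined, and beyond them the q-series diverge. The defining identity of g_k is taken for z near 0. *)

theory Defs
  imports "HOL-Analysis.Analysis" "HOL-Library.Multiset"
begin

text \<open>
  \<open>epow w r\<close> is $e^{2\pi i r w}$: thus \<open>epow \<tau> r\<close> stands for $q^r$ and \<open>epow z r\<close> for $\zeta^r$,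
  with the branch of fractional powers fixed by $\tau$ and $z$.
\<close>

definition epow :: "complex \<Rightarrow> real \<Rightarrow> complex" where
  "epow w r = exp (2 * of_real pi * \<i> * of_real r * w)"

definition partial_theta :: "complex \<Rightarrow> complex \<Rightarrow> complex" where
  "partial_theta z \<tau> =
     2 * \<i> * (\<Sum>n. (-1) ^ n * epow z (real n + 1/2) * epow \<tau> ((real n + 1/2)\<^sup>2 / 2))"

definition partial_theta0 :: "complex \<Rightarrow> complex" where
  "partial_theta0 \<tau> = partial_theta 0 \<tau>"

text \<open>
  The defining identity of the partial Eisenstein series is required for all \<open>z\<close> near 0. If
  $T_0(\tau) \neq 0$, it determines the coefficients with $k \ge 1$ (the value at \<open>k = 0\<close> is
  irrelevant); if $T_0(\tau) = 0$, no coefficients satisfy it and the series are undefined at \<open>\<tau>\<close>.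
\<close>

definition partial_Eisenstein_identity :: "complex \<Rightarrow> (nat \<Rightarrow> complex) \<Rightarrow> bool" where
  "partial_Eisenstein_identity \<tau> c \<longleftrightarrow>
     (\<forall>\<^sub>F z in nhds 0.
        (\<lambda>k. c k * (2 * of_real pi * \<i> * z) ^ k / fact k) summable_on {1..} \<and>
        partial_theta z \<tau> =
          partial_theta0 \<tau> *
            exp (- (\<Sum>\<^sub>\<infinity>k\<in>{1..}. c k * (2 * of_real pi * \<i> * z) ^ k / fact k)))"

definition partial_Eisenstein :: "nat \<Rightarrow> complex \<Rightarrow> complex" where
  "partial_Eisenstein k \<tau> = (SOME c. partial_Eisenstein_identity \<tau> c) k"

text \<open>
  Partitions are multisets of positive integers: \<open>count \<mu> j\<close> is the multiplicity $m_j$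
  and \<open>size \<mu>\<close> the length.
\<close>

definition is_partition :: "nat \<Rightarrow> nat multiset \<Rightarrow> bool" where
  "is_partition n \<mu> \<longleftrightarrow> 0 \<notin># \<mu> \<and> sum_mset \<mu> = n"

definition Lambda :: "nat \<Rightarrow> nat \<Rightarrow> nat multiset set" where
  "Lambda n m =
     {\<mu>. is_partition n \<mu> \<and> (\<forall>j\<in>{1..<n}. count \<mu> j \<ge> count \<mu> (Suc j)) \<and> size \<mu> = m}"

text \<open>
  For \<open>\<mu>\<close> in \<open>Lambda n m\<close> the differences $m_j - m_{j+1}$ with $1 \le j \le n$ are nonnegative
  and sum to $m_1$ (as $m_{n+1} = 0$), so the quotient of factorials is the multinomial coefficient.
\<close>

definition multinom :: "nat \<Rightarrow> nat multiset \<Rightarrow> real" where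
  "multinom n \<mu> =
     fact (count \<mu> 1) / (\<Prod>j=1..n. fact (count \<mu> j - count \<mu> (Suc j)))"

definition a_coeff :: "nat \<Rightarrow> nat \<Rightarrow> real" where
  "a_coeff n m =
     (\<Sum>\<mu>\<in>Lambda n m.
        (-1) ^ (m + count \<mu> 1) * (real m / real (count \<mu> 1)) * multinom n \<mu>)"

text \<open>
  $T_0$ has zeros in the upper half-plane (the first ones occur for $|q|$ between 0.75 and 0.8),
  and there the functions $g_k$ are undefined. An expansion
  $T_0 = 2 i q^{1/8} \exp(\ldots)$ with a convergent power series in $q$ in the exponent can only
  hold where $|q|$ does not exceed the modulus of any such zero.
  The domain below is the corresponding half-plane $\mathrm{Im}\,\tau > y_0$.
\<close>

definition in_expansion_domain :: "complex \<Rightarrow> bool" where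
  "in_expansion_domain \<tau> \<longleftrightarrow>
     Im \<tau> > 0 \<and> (\<forall>\<tau>'. Im \<tau>' \<ge> Im \<tau> \<longrightarrow> partial_theta0 \<tau>' \<noteq> 0)"

end

theory Submission
  imports Defs "HOL-Complex_Analysis.Complex_Analysis" "HOL-Combinatorics.Multiset_Permutations"
begin

unbundle no vec_syntax

text \<open>
  Up to the factor $2 i \zeta^{1/2} q^{1/8}$, the partial theta function is
  $\theta(\zeta, q) = 1 + \sum_{j \ge 1} (-\zeta)^j q^{j(j+1)/2}$. Expanding $\log(1 + X)$ formally
  in $q$ by the multinomial theorem and conjugating partitions gives
  $-\log \theta(\zeta, q) = \sum_n \sum_m \frac{a_{n,m}}{m} \zeta^m q^n$. If $\theta(1, \cdot)$
  has no zero in a closed disc, then by compactness neither has $\theta(e^w, \cdot)$ in a slightly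
  larger disc, for all small $w$, and the logarithm is bounded there uniformly in $w$. Cauchy's
  inequality, applied first in $q$ and then in $w$, makes the double series in $q$ and $w$
  absolutely convergent; summing over $n$ first yields the power series in $w = 2 \pi i z$ that
  defines the $g_k$.
\<close>

section \<open>Partitions with decreasing multiplicities\<close>

text \<open>Bounding the partition sums term by term would give convergence only where 1 - \<Sum>_{j
  \<ge> 1} |q|^(j(j+1)/2) is positive, that is for |q| below about 0.65, short of the first zeros of
  T_0. Beyond that the terms cancel, so the bounds have to come from the logarithm itself. Upper and
  lower bounds on |\<theta>| do not control its argument, but they control the logarithmic
  derivative, which is then integrated from q = 0. The logarithm therefore occurs twice: formally,
  where the partitions appear, and analytically, where the bounds appear. Both versions solve L'
  \<theta> = \<theta>' with L(0) = 0, and this identifies their coefficients. The coefficient of q^n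
  is a polynomial in \<zeta> = e^w and hence entire in w, so Cauchy's inequality in w asks only for
  a bound uniform in w.\<close>

definition tri :: "nat \<Rightarrow> nat" where "tri j = \<Sum>{1..j}"

lemma tri_0 [simp]: "tri 0 = 0" and tri_Suc [simp]: "tri (Suc j) = tri j + Suc j"
  by (simp_all add: tri_def)

lemma two_tri: "2 * tri j = j * (j + 1)"
  by (induction j) auto

lemma tri_ge: "j \<le> tri j"
  by (induction j) auto

lemma strict_mono_tri: "strict_mono tri"
  by (rule strict_monoI_Suc) simp

lemma tri_add_le: "tri i + tri j \<le> tri (i + j)"
  by (induction j) auto

text \<open>Partitions of n into triangular numbers, recorded by their indices:
  \<open>sum_mset \<nu>\<close> is then the exponent of \<zeta>, and \<open>size \<nu>\<close> the
  power of X in the expansion of log(1 + X).\<close>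

definition triangular_partitions :: "nat \<Rightarrow> nat multiset set" where
  "triangular_partitions n = {\<nu>. 0 \<notin># \<nu> \<and> (\<Sum>i\<in>#\<nu>. tri i) = n}"

text \<open>
  Under conjugation the condition $m_1 \ge m_2 \ge \cdots$ disappears: the differences
  $m_j - m_{j+1}$ become free multiplicities, and a part $i$ of the conjugate accounts for one
  part of each size $1, \dots, i$, that is, for \<open>tri i\<close> in the sum.
\<close>

definition conjugate :: "nat multiset \<Rightarrow> nat multiset" where
  "conjugate \<nu> = (\<Sum>i\<in>#\<nu>. mset_set {1..i})"

lemma conjugate_empty [simp]: "conjugate {#} = {#}"
  and conjugate_add [simp]: "conjugate (add_mset i \<nu>) = mset_set {1..i} + conjugate \<nu>"
  by (simp_all add: conjugate_def)

lemma count_conjugate: "j \<ge> 1 \<Longrightarrow> count (conjugate \<nu>) j = size (filter_mset (\<lambda>i. j \<le> i) \<nu>)"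
  by (induction \<nu>) (auto simp: count_mset_set')

lemma size_conjugate: "size (conjugate \<nu>) = sum_mset \<nu>"
  by (induction \<nu>) auto

lemma sum_conjugate: "sum_mset (conjugate \<nu>) = (\<Sum>i\<in>#\<nu>. tri i)"
  by (induction \<nu>) (auto simp: tri_def sum_unfold_sum_mset)

lemma zero_notin_conjugate: "0 \<notin># conjugate \<nu>"
  by (induction \<nu>) auto

lemma size_filter_ge_Suc:
  "size (filter_mset (\<lambda>i. j \<le> i) \<nu>) = count \<nu> j + size (filter_mset (\<lambda>i. Suc j \<le> i) \<nu>)"
  by (induction \<nu>) auto

lemma count_conjugate_diff:
  "j \<ge> 1 \<Longrightarrow> count (conjugate \<nu>) j = count \<nu> j + count (conjugate \<nu>) (Suc j)"
  using size_filter_ge_Suc[of j \<nu>] by (simp only: count_conjugate)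

lemma filter_ge_1: "0 \<notin># \<nu> \<Longrightarrow> filter_mset (\<lambda>i. 1 \<le> i) \<nu> = \<nu>" for \<nu> :: "nat multiset"
  by (induction \<nu>) auto

lemma count_conjugate_1: "0 \<notin># \<nu> \<Longrightarrow> count (conjugate \<nu>) 1 = size \<nu>"
  using count_conjugate[of 1 \<nu>] filter_ge_1[of \<nu>] by simp

lemma sum_mset_set_count: "(\<Sum>i\<in>#\<nu>. f i) = (\<Sum>j\<in>set_mset \<nu>. count \<nu> j * f j)" for f :: "'a \<Rightarrow> nat"
proof -
  \<comment> \<open>A fixed finite superset \<open>A\<close> keeps the index set unchanged when an
    element is added in the induction.\<close>
  have "(\<Sum>j\<in>A. count \<nu> j * f j) = (\<Sum>i\<in>#\<nu>. f i)" if "finite A" "set_mset \<nu> \<subseteq> A" for A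
    using that
  proof (induction \<nu>)
    case (add x \<nu>)
    have "(\<Sum>j\<in>A. count (add_mset x \<nu>) j * f j) = (\<Sum>j\<in>A. (if j = x then f j else 0) + count \<nu> j * f j)"
      by (intro sum.cong) auto
    also have "\<dots> = (\<Sum>j\<in>A. if j = x then f j else 0) + (\<Sum>j\<in>A. count \<nu> j * f j)"
      by (rule sum.distrib)
    also have "(\<Sum>j\<in>A. count \<nu> j * f j) = (\<Sum>i\<in>#\<nu>. f i)"
      using add by auto
    also have "(\<Sum>j\<in>A. if j = x then f j else 0) = f x"
      using add.prems by simp
    finally show ?case by simp
  qed simp
  thus ?thesis by simp
qed

lemma elem_le_sum: "i \<in># \<nu> \<Longrightarrow> f i \<le> (\<Sum>i\<in>#\<nu>. f i)" for f :: "'a \<Rightarrow> nat"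
  by (induction \<nu>) auto

lemma sum_mset_mono_nat: "(\<And>i. i \<in># \<nu> \<Longrightarrow> f i \<le> g i) \<Longrightarrow> (\<Sum>i\<in>#\<nu>. f i) \<le> (\<Sum>i\<in>#\<nu>. g i)"
  for f :: "'a \<Rightarrow> nat"
  by (induction \<nu>) (auto intro: add_mono)

lemma triangular_partitions_set: "\<nu> \<in> triangular_partitions n \<Longrightarrow> set_mset \<nu> \<subseteq> {1..n}"
proof
  fix i assume \<nu>: "\<nu> \<in> triangular_partitions n" and i: "i \<in># \<nu>"
  have "i \<le> n" using elem_le_sum[OF i, of tri] tri_ge[of i] \<nu> by (auto simp: triangular_partitions_def)
  moreover have "i \<noteq> 0" using \<nu> i by (metis (mono_tags, lifting) triangular_partitions_def mem_Collect_eq)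
  ultimately show "i \<in> {1..n}" by simp
qed

lemma triangular_partitions_sum_le: "\<nu> \<in> triangular_partitions n \<Longrightarrow> sum_mset \<nu> \<le> n"
  using sum_mset_mono_nat[of \<nu> "\<lambda>i. i" tri] tri_ge by (auto simp: triangular_partitions_def)

lemma size_le_sum_mset: "0 \<notin># \<nu> \<Longrightarrow> size \<nu> \<le> sum_mset \<nu>" for \<nu> :: "nat multiset"
  by (induction \<nu>) auto

lemma triangular_partitions_size_le: "\<nu> \<in> triangular_partitions n \<Longrightarrow> size \<nu> \<le> sum_mset \<nu>"
  using size_le_sum_mset[of \<nu>] by (simp add: triangular_partitions_def)

text \<open>Since \<open>tri\<close> is superadditive, merging all parts into a single one can only
  increase the sum.\<close>

lemma sum_tri_le: "(\<Sum>i\<in>#\<nu>. tri i) \<le> tri (sum_mset \<nu>)"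
proof (induction \<nu>)
  case (add i \<nu>)
  thus ?case using tri_add_le[of i "sum_mset \<nu>"] by simp
qed simp

lemma triangular_partitions_nonempty: "\<nu> \<in> triangular_partitions n \<Longrightarrow> n \<ge> 1 \<Longrightarrow> \<nu> \<noteq> {#}"
  by (auto simp: triangular_partitions_def)

lemma finite_triangular_partitions: "finite (triangular_partitions n)"
proof -
  have "triangular_partitions n \<subseteq> mset ` {xs. set xs \<subseteq> {1..n} \<and> length xs \<le> n}"
  proof
    fix \<nu> assume \<nu>: "\<nu> \<in> triangular_partitions n"
    obtain xs where xs: "mset xs = \<nu>" using ex_mset by blast
    have "size \<nu> \<le> n" using triangular_partitions_size_le[OF \<nu>] triangular_partitions_sum_le[OF \<nu>] by simp
    with xs triangular_partitions_set[OF \<nu>] show "\<nu> \<in> mset ` {xs. set xs \<subseteq> {1..n} \<and> length xs \<le> n}"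
      by (intro image_eqI[of _ _ xs]) auto
  qed
  moreover have "finite {xs. set xs \<subseteq> {1..n} \<and> length xs \<le> n}"
    by (rule finite_lists_length_le) simp
  ultimately show ?thesis by (meson finite_surj)
qed

text \<open>The inverse of \<open>conjugate\<close> on \<open>Lambda n m\<close>; there the
  truncated subtraction is exact.\<close>

definition differences :: "nat \<Rightarrow> nat multiset \<Rightarrow> nat multiset" where
  "differences n \<mu> = (\<Sum>j\<in>{1..n}. replicate_mset (count \<mu> j - count \<mu> (Suc j)) j)"

lemma count_differences:
  "count (differences n \<mu>) j = (if j \<in> {1..n} then count \<mu> j - count \<mu> (Suc j) else 0)"
proof -
  have "count (differences n \<mu>) j =
      (\<Sum>i\<in>{1..n}. if i = j then count \<mu> i - count \<mu> (Suc i) else 0)"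
    unfolding differences_def count_sum by (intro sum.cong refl) auto
  thus ?thesis by simp
qed

lemma count_partition_gt: "is_partition n \<mu> \<Longrightarrow> j > n \<Longrightarrow> count \<mu> j = 0"
  using elem_le_sum[of j \<mu> "\<lambda>i. i"] by (auto simp: is_partition_def not_in_iff[symmetric])

text \<open>The multiplicities of a conjugate are tail sums, and the tail sums of the differences
  m_i - m_{i+1} telescope. The induction descends from n + 1, where both counts vanish.\<close>

lemma conjugate_differences:
  assumes \<mu>: "\<mu> \<in> Lambda n m"
  shows "conjugate (differences n \<mu>) = \<mu>"
proof (rule multiset_eqI)
  fix j
  let ?\<nu> = "differences n \<mu>"
  have part: "is_partition n \<mu>" using \<mu> by (auto simp: Lambda_def)
  \<comment> \<open>\<open>Lambda\<close> compares multiplicities only up to m_n; after that the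
    next one is 0, because no part exceeds n.\<close>
  have le: "count \<mu> (Suc j) \<le> count \<mu> j" if "j \<ge> 1" for j
  proof (cases "j < n")
    case True
    thus ?thesis using \<mu> that by (simp add: Lambda_def)
  next
    case False
    thus ?thesis using count_partition_gt[OF part, of "Suc j"] by simp
  qed
  have big: "count (conjugate ?\<nu>) j = count \<mu> j" if "j > n" for j
  proof -
    have "i \<notin># ?\<nu>" if "i > n" for i
      unfolding not_in_iff count_differences using that by auto
    hence "filter_mset (\<lambda>i. j \<le> i) ?\<nu> = {#}"
      using that unfolding filter_mset_eq_mempty_iff by (meson leD leI le_trans)
    with that show ?thesis using count_partition_gt[OF part, of j] by (simp add: count_conjugate)
  qed
  have mid: "count (conjugate ?\<nu>) j = count \<mu> j" if "j \<le> Suc n" "1 \<le> j" for j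
    using that
  proof (induction j rule: inc_induct)
    case base thus ?case by (intro big) auto
  next
    case (step j)
    have "count (conjugate ?\<nu>) j = count ?\<nu> j + count \<mu> (Suc j)"
      using step count_conjugate_diff[of j ?\<nu>] by simp
    with step le[of j] show ?case by (simp add: count_differences)
  qed
  show "count (conjugate ?\<nu>) j = count \<mu> j"
  proof (cases "j = 0")
    case True
    thus ?thesis using zero_notin_conjugate[of ?\<nu>] part
      by (simp add: is_partition_def not_in_iff)
  next
    case False
    with mid[of j] big[of j] show ?thesis by linarith
  qed
qed

lemma zero_notin_differences: "0 \<notin># differences n \<mu>"
  by (simp add: not_in_iff count_differences)

lemma differences_conjugate:
  assumes \<nu>: "\<nu> \<in> triangular_partitions n" shows "differences n (conjugate \<nu>) = \<nu>"
proof (rule multiset_eqI)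
  fix j
  have "count \<nu> j = 0" if "j \<notin> {1..n}" using triangular_partitions_set[OF \<nu>] that by (auto simp: count_eq_zero_iff)
  thus "count (differences n (conjugate \<nu>)) j = count \<nu> j"
    using count_conjugate_diff[of j \<nu>] by (auto simp: count_differences)
qed

lemma bij_conjugate:
  "bij_betw conjugate {\<nu> \<in> triangular_partitions n. sum_mset \<nu> = m} (Lambda n m)"
proof (rule bij_betw_byWitness[where f' = "differences n"])
  show "conjugate ` {\<nu> \<in> triangular_partitions n. sum_mset \<nu> = m} \<subseteq> Lambda n m"
  proof safe
    fix \<nu> assume \<nu>: "\<nu> \<in> triangular_partitions n"
    have "count (conjugate \<nu>) (Suc j) \<le> count (conjugate \<nu>) j" if "j \<in> {1..<n}" for j
      using that count_conjugate_diff[of j \<nu>] by simp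
    thus "conjugate \<nu> \<in> Lambda n (sum_mset \<nu>)"
      using \<nu> by (simp add: Lambda_def triangular_partitions_def is_partition_def size_conjugate sum_conjugate zero_notin_conjugate)
  qed
  show "differences n ` Lambda n m \<subseteq> {\<nu> \<in> triangular_partitions n. sum_mset \<nu> = m}"
  proof safe
    fix \<mu> assume \<mu>: "\<mu> \<in> Lambda n m"
    note eq = conjugate_differences[OF \<mu>]
    show "differences n \<mu> \<in> triangular_partitions n"
      using \<mu> sum_conjugate[of "differences n \<mu>"] zero_notin_differences
      unfolding eq by (auto simp: triangular_partitions_def Lambda_def is_partition_def)
    show "sum_mset (differences n \<mu>) = m"
      using \<mu> size_conjugate[of "differences n \<mu>"] unfolding eq by (auto simp: Lambda_def)
  qed
qed (auto simp: differences_conjugate conjugate_differences)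

text \<open>The differences m_j - m_{j+1} are the multiplicities in \<nu>, and m_1 is the number of
  its parts, so the multinomial coefficient counts the orderings of \<nu>.\<close>

lemma multinom_conjugate:
  assumes \<nu>: "\<nu> \<in> triangular_partitions n"
  shows "multinom n (conjugate \<nu>) = card (permutations_of_multiset \<nu>)"
proof -
  have "(\<Prod>j=1..n. fact (count (conjugate \<nu>) j - count (conjugate \<nu>) (Suc j)) :: real)
      = (\<Prod>j=1..n. fact (count \<nu> j))"
  proof (intro prod.cong refl)
    fix j assume "j \<in> {1..n}"
    thus "fact (count (conjugate \<nu>) j - count (conjugate \<nu>) (Suc j)) = (fact (count \<nu> j) :: real)"
      using count_conjugate_diff[of j \<nu>] by simp
  qed
  also have "\<dots> = (\<Prod>j\<in>set_mset \<nu>. fact (count \<nu> j))"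
    using triangular_partitions_set[OF \<nu>] by (intro prod.mono_neutral_right) (auto simp: count_eq_zero_iff[symmetric])
  also have "\<dots> = real (\<Prod>j\<in>set_mset \<nu>. fact (count \<nu> j))" by simp
  finally have 1: "(\<Prod>j=1..n. fact (count (conjugate \<nu>) j - count (conjugate \<nu>) (Suc j)) :: real) = \<dots>" .
  have "real (card (permutations_of_multiset \<nu>)) * real (\<Prod>j\<in>set_mset \<nu>. fact (count \<nu> j)) = fact (size \<nu>)"
    unfolding of_nat_mult[symmetric] card_permutations_of_multiset_aux by simp
  moreover have "real (\<Prod>j\<in>set_mset \<nu>. fact (count \<nu> j)) \<noteq> 0" by simp
  moreover have "count (conjugate \<nu>) 1 = size \<nu>"
    using \<nu> by (intro count_conjugate_1) (simp add: triangular_partitions_def)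
  ultimately show ?thesis
    unfolding multinom_def 1 by (simp add: divide_eq_eq del: of_nat_prod)
qed

section \<open>Integrality and vanishing of the coefficients\<close>

lemma a_coeff_eq:
  "a_coeff n m = (\<Sum>\<nu> | \<nu> \<in> triangular_partitions n \<and> sum_mset \<nu> = m.
     (-1) ^ (m + size \<nu>) * (real m / real (size \<nu>)) * card (permutations_of_multiset \<nu>))"
  unfolding a_coeff_def sum.reindex_bij_betw[OF bij_conjugate, symmetric]
  by (intro sum.cong refl) (auto simp: multinom_conjugate count_conjugate_1[unfolded One_nat_def] triangular_partitions_def)

text \<open>Sort the orderings of \<nu> by their first entry: those beginning with j make up the
  fraction count \<nu> j / size \<nu> of all, and are as many as the orderings of \<nu> with one j
  removed. Weighting by j gives the left side, which is thus an integer despite the factor m /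
  m_1.\<close>

lemma sum_mset_times_permutations:
  assumes "\<nu> \<noteq> {#}"
  shows "real (sum_mset \<nu>) / real (size \<nu>) * card (permutations_of_multiset \<nu>) =
    (\<Sum>j\<in>set_mset \<nu>. real (j * card (permutations_of_multiset (\<nu> - {#j#}))))"
proof -
  have "sum_mset \<nu> = (\<Sum>j\<in>set_mset \<nu>. count \<nu> j * j)"
    using sum_mset_set_count[of id \<nu>] by simp
  hence "real (sum_mset \<nu>) / real (size \<nu>) * card (permutations_of_multiset \<nu>) =
    (\<Sum>j\<in>set_mset \<nu>. real j * (real (card (permutations_of_multiset \<nu>) * count \<nu> j) / real (size \<nu>)))"
    by (simp add: sum_distrib_right sum_distrib_left sum_divide_distrib mult_ac)
  also have "\<dots> = (\<Sum>j\<in>set_mset \<nu>. real (j * card (permutations_of_multiset (\<nu> - {#j#}))))"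
    by (intro sum.cong refl) (simp add: real_card_permutations_of_multiset_remove)
  finally show ?thesis .
qed

lemma a_coeff_int:
  assumes "n \<ge> 1"
  shows "a_coeff n m \<in> \<int>"
  unfolding a_coeff_eq
proof (intro Ints_sum)
  fix \<nu> assume \<nu>: "\<nu> \<in> {\<nu>. \<nu> \<in> triangular_partitions n \<and> sum_mset \<nu> = m}"
  have "real m / real (size \<nu>) * card (permutations_of_multiset \<nu>) \<in> \<int>"
  proof -
    have "\<nu> \<noteq> {#}" using triangular_partitions_nonempty[of \<nu> n] \<nu> assms by blast
    moreover have "(\<Sum>j\<in>set_mset \<nu>. real (j * card (permutations_of_multiset (\<nu> - {#j#})))) \<in> \<int>"
      by (intro Ints_sum Ints_of_nat)
    moreover have "sum_mset \<nu> = m" using \<nu> by simp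
    ultimately show ?thesis using sum_mset_times_permutations[of \<nu>] by metis
  qed
  thus "(-1) ^ (m + size \<nu>) * (real m / real (size \<nu>)) * card (permutations_of_multiset \<nu>) \<in> \<int>"
    by (metis Ints_1 Ints_minus Ints_mult Ints_power mult.assoc)
qed

text \<open>The threshold is the positive solution of x(x+1)/2 = n. Below it \<open>tri m\<close> <
  n, so by \<open>sum_tri_le\<close> the sum over partitions is empty.\<close>

lemma a_coeff_0:
  assumes "int m < \<lceil>(sqrt (8 * real n + 1) - 1) / 2\<rceil>"
  shows "a_coeff n m = 0"
proof -
  have "triangular_partitions n \<inter> {\<nu>. sum_mset \<nu> = m} = {}"
  proof safe
    fix \<nu> assume \<nu>: "\<nu> \<in> triangular_partitions n" "m = sum_mset \<nu>"
    have "real m < (sqrt (8 * real n + 1) - 1) / 2" using assms by linarith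
    hence "2 * real m + 1 < sqrt (8 * real n + 1)" by (simp add: field_simps)
    hence "(2 * real m + 1)\<^sup>2 < 8 * real n + 1"
      by (metis add_nonneg_nonneg linorder_not_less mult_nonneg_nonneg of_nat_0_le_iff real_le_lsqrt zero_le_numeral zero_le_one)
    hence "real (4 * (m * (m + 1))) < real (8 * n)" by (simp add: power2_eq_square algebra_simps)
    hence "4 * (m * (m+1)) < 8 * n" by linarith
    with two_tri[of m] have "tri m < n" by simp
    with sum_tri_le[of \<nu>] \<nu> show "\<nu> \<in> {}" by (auto simp: triangular_partitions_def)
  qed
  hence "{\<nu>. \<nu> \<in> triangular_partitions n \<and> sum_mset \<nu> = m} = {}" by blast
  thus ?thesis unfolding a_coeff_eq by (simp only: sum.empty)
qed

section \<open>The formal logarithm\<close>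

text \<open>The lacunary series \<Sum> (-\<zeta>)^j X^(tri j) in X = q. Only q is formal; \<zeta>
  stays a complex number, since the estimates are made at fixed \<zeta> = e^w.\<close>

definition theta_fps :: "complex \<Rightarrow> complex fps" where
  "theta_fps \<zeta> = Abs_fps (\<lambda>t. if t \<in> range tri then (-\<zeta>) ^ (inv tri t) else 0)"

text \<open>The coefficient of q^n in -log \<theta>(\<zeta>, q).\<close>

definition log_coeff :: "nat \<Rightarrow> complex \<Rightarrow> complex" where
  "log_coeff n \<zeta> = (\<Sum>m=1..n. of_real (a_coeff n m) / of_nat m * \<zeta> ^ m)"

lemma inj_tri: "inj tri"
  using strict_mono_tri by (rule strict_mono_imp_inj_on)

lemma theta_fps_tri [simp]: "theta_fps \<zeta> $ tri n = (-\<zeta>) ^ n"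
  by (simp add: theta_fps_def inv_f_f inj_tri)

lemma theta_fps_0 [simp]: "theta_fps \<zeta> $ 0 = 1"
  using theta_fps_tri[of \<zeta> 0] by simp

text \<open>Serves to replace the infinite series by a finite sum of monomials when a single
  coefficient of a power is wanted.\<close>

lemma fps_power_cong_le:
  fixes f g :: "'a::comm_ring_1 fps"
  assumes "\<And>i. i \<le> n \<Longrightarrow> f $ i = g $ i" "i \<le> n"
  shows "(f ^ r) $ i = (g ^ r) $ i"
  using assms(2)
proof (induction r arbitrary: i)
  case (Suc r)
  have "(\<Sum>k=0..i. f $ k * f ^ r $ (i - k)) = (\<Sum>k=0..i. g $ k * g ^ r $ (i - k))"
    using Suc assms(1) by (intro sum.cong refl) auto
  thus ?case by (simp add: fps_mult_nth)
qed simp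

text \<open>The multinomial theorem before equal terms are collected. Grouping the lists by
  \<open>mset\<close> later produces the number of orderings as coefficient.\<close>

lemma sum_power_lists:
  fixes f :: "'b \<Rightarrow> 'a::comm_semiring_1"
  assumes "finite A"
  shows "(\<Sum>j\<in>A. f j) ^ r = (\<Sum>xs | set xs \<subseteq> A \<and> length xs = r. prod_list (map f xs))"
proof (induction r)
  case 0
  have "{xs. set xs \<subseteq> A \<and> length xs = 0} = {[]}" by auto
  thus ?case by simp
next
  case (Suc r)
  let ?L = "{xs. set xs \<subseteq> A \<and> length xs = r}"
  have "{xs. set xs \<subseteq> A \<and> length xs = Suc r} = (\<lambda>(x, xs). x # xs) ` (A \<times> ?L)"
    by (auto simp: length_Suc_conv)
  hence "(\<Sum>xs | set xs \<subseteq> A \<and> length xs = Suc r. prod_list (map f xs)) =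
      (\<Sum>(x, xs)\<in>A \<times> ?L. f x * prod_list (map f xs))"
    by (simp only:) (subst sum.reindex; auto simp: inj_on_def case_prod_unfold)
  also have "\<dots> = (\<Sum>x\<in>A. \<Sum>xs\<in>?L. f x * prod_list (map f xs))"
    by (rule sum.cartesian_product[symmetric])
  finally show ?case using Suc by (simp add: sum_product)
qed

text \<open>Because \<open>tri j\<close> \<ge> j, indices j > n do not reach the coefficients up to
  n.\<close>

lemma theta_fps_minus_1_nth:
  fixes \<zeta> :: complex
  assumes "t \<le> n"
  shows "(theta_fps \<zeta> - 1) $ t = (\<Sum>j=1..n. fps_const ((-\<zeta>) ^ j) * fps_X ^ tri j) $ t"
proof -
  have rhs: "(\<Sum>j=1..n. fps_const ((-\<zeta>) ^ j) * fps_X ^ tri j) $ t =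
      (\<Sum>j=1..n. if t = tri j then (-\<zeta>) ^ j else 0)"
    unfolding fps_sum_nth by (intro sum.cong refl) simp
  show ?thesis
  proof (cases "t \<in> range tri")
    case False
    hence "(\<Sum>j=1..n. if t = tri j then (-\<zeta>) ^ j else 0) = 0" by (intro sum.neutral) auto
    moreover have "t \<noteq> 0" using False tri_0 by (metis rangeI)
    ultimately show ?thesis using False unfolding rhs by (simp add: theta_fps_def)
  next
    case True
    then obtain i where i: "t = tri i" by blast
    have "(\<Sum>j=1..n. if t = tri j then (-\<zeta>) ^ j else 0) = (\<Sum>j=1..n. if i = j then (-\<zeta>) ^ j else 0)"
      using inj_tri unfolding i by (intro sum.cong refl) (simp add: inj_eq)
    also have "\<dots> = (if i \<in> {1..n} then (-\<zeta>) ^ i else 0)" by simp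
    also have "\<dots> = (theta_fps \<zeta> - 1) $ t"
      using tri_ge[of i] assms unfolding i by (cases "i = 0") auto
    finally show ?thesis unfolding rhs ..
  qed
qed

lemma prod_list_monomials:
  "prod_list (map (\<lambda>j. fps_const (c ^ j) * fps_X ^ tri j) xs) =
     fps_const (c ^ sum_list xs) * fps_X ^ (\<Sum>j\<leftarrow>xs. tri j)" for c :: "'a::comm_ring_1"
proof (induction xs)
  case (Cons x xs)
  have "fps_const (c ^ x) * fps_X ^ tri x * (fps_const (c ^ sum_list xs) * fps_X ^ (\<Sum>j\<leftarrow>xs. tri j))
      = (fps_const (c ^ x) * fps_const (c ^ sum_list xs)) * (fps_X ^ tri x * fps_X ^ (\<Sum>j\<leftarrow>xs. tri j))"
    by (simp only: mult_ac)
  with Cons show ?case by (simp add: power_add)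
qed simp

text \<open>Each choice of one monomial per factor is a word in the indices; the words with the same
  underlying multiset \<nu> contribute equally and are exactly the orderings of \<nu>.\<close>

lemma theta_fps_minus_1_power_nth:
  fixes \<zeta> :: complex
  shows
  "(theta_fps \<zeta> - 1) ^ r $ n =
     (\<Sum>\<nu> | \<nu> \<in> triangular_partitions n \<and> size \<nu> = r. card (permutations_of_multiset \<nu>) * (-\<zeta>) ^ sum_mset \<nu>)"
proof -
  let ?L = "{xs. set xs \<subseteq> {1..n} \<and> length xs = r}"
  let ?L' = "{xs \<in> ?L. (\<Sum>j\<leftarrow>xs. tri j) = n}"
  let ?T = "{\<nu> \<in> triangular_partitions n. size \<nu> = r}"
  have fin: "finite ?L" by (rule finite_lists_length_eq) simp
  have "(theta_fps \<zeta> - 1) ^ r $ n = (\<Sum>j=1..n. fps_const ((-\<zeta>) ^ j) * fps_X ^ tri j) ^ r $ n"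
    by (rule fps_power_cong_le[OF theta_fps_minus_1_nth]) auto
  also have "\<dots> = (\<Sum>xs\<in>?L. if n = (\<Sum>j\<leftarrow>xs. tri j) then (-\<zeta>) ^ sum_list xs else 0)"
    unfolding sum_power_lists[OF finite_atLeastAtMost] prod_list_monomials fps_sum_nth
    by (intro sum.cong refl) simp
  also have "\<dots> = (\<Sum>xs\<in>?L'. (-\<zeta>) ^ sum_list xs)"
    using fin by (subst sum.inter_filter) (auto intro: sum.cong)
  also have "\<dots> = (\<Sum>\<nu>\<in>?T. \<Sum>xs | xs \<in> ?L' \<and> mset xs = \<nu>. (-\<zeta>) ^ sum_list xs)"
  proof (rule sum.group[symmetric])
    show "mset ` ?L' \<subseteq> ?T"
    proof
      fix \<nu> assume "\<nu> \<in> mset ` ?L'"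
      then obtain xs where xs: "set xs \<subseteq> {1..n}" "length xs = r" "(\<Sum>j\<leftarrow>xs. tri j) = n" "\<nu> = mset xs"
        by blast
      have "0 \<notin> set xs" using xs(1) by auto
      moreover have "(\<Sum>i\<in>#mset xs. tri i) = n"
        using xs(3) by (metis mset_map sum_mset_sum_list)
      ultimately show "\<nu> \<in> ?T" using xs by (simp add: triangular_partitions_def)
    qed
  next
    show "finite ?L'" using fin by (rule finite_subset[rotated]) blast
  qed (use finite_triangular_partitions in simp)
  also have "\<dots> = (\<Sum>\<nu>\<in>?T. \<Sum>xs\<in>permutations_of_multiset \<nu>. (-\<zeta>) ^ sum_mset \<nu>)"
  proof (intro sum.cong refl)
    fix \<nu> assume \<nu>: "\<nu> \<in> ?T"
    have "xs \<in> ?L'" if "mset xs = \<nu>" for xs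
    proof -
      have "(\<Sum>j\<leftarrow>xs. tri j) = n"
        using \<nu> that by (metis (mono_tags, lifting) triangular_partitions_def mem_Collect_eq mset_map sum_mset_sum_list)
      moreover have "set xs \<subseteq> {1..n}" using triangular_partitions_set[of \<nu> n] \<nu> that by auto
      moreover have "length xs = r" using \<nu> that by auto
      ultimately show ?thesis by blast
    qed
    thus "{xs. xs \<in> ?L' \<and> mset xs = \<nu>} = permutations_of_multiset \<nu>"
      by (auto simp: permutations_of_multiset_def)
  qed (auto simp: permutations_of_multiset_def sum_mset_sum_list)
  finally show ?thesis by simp
qed

text \<open>The series of log(1 + X) groups the partitions by the number r of parts with weight
  (-1)^(r-1) / r, whereas \<open>a_coeff\<close> groups them by their sum m. Regrouping works
  because (m / r) / m = 1 / r and (-1)^(r-1) (-1)^m = -(-1)^(m+r).\<close>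

lemma fps_ln_theta_nth:
  assumes "n \<ge> 1"
  shows "(fps_ln 1 oo (theta_fps \<zeta> - 1)) $ n = - log_coeff n \<zeta>"
proof -
  define h where "h \<nu> = (-1) ^ (size \<nu> - 1) / of_nat (size \<nu>) *
      (of_nat (card (permutations_of_multiset \<nu>)) * (-\<zeta>) ^ sum_mset \<nu>)" for \<nu> :: "nat multiset"
  have "(fps_ln 1 oo (theta_fps \<zeta> - 1)) $ n = (\<Sum>r=0..n. \<Sum>\<nu> | \<nu> \<in> triangular_partitions n \<and> size \<nu> = r. h \<nu>)"
    unfolding fps_compose_nth theta_fps_minus_1_power_nth sum_distrib_left
  proof (intro sum.cong refl)
    fix r \<nu> assume \<nu>: "\<nu> \<in> {\<nu>. \<nu> \<in> triangular_partitions n \<and> size \<nu> = r}"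
    with triangular_partitions_nonempty[of \<nu> n] assms have "\<nu> \<noteq> {#}" by blast
    with \<nu> have "r \<noteq> 0" "size \<nu> = r" by (metis (mono_tags) mem_Collect_eq size_eq_0_iff_empty)+
    thus "fps_ln 1 $ r * (of_nat (card (permutations_of_multiset \<nu>)) * (- \<zeta>) ^ sum_mset \<nu>) = h \<nu>"
      by (simp add: h_def fps_ln_nth)
  qed
  also have "\<dots> = (\<Sum>\<nu>\<in>triangular_partitions n. h \<nu>)"
    using triangular_partitions_size_le triangular_partitions_sum_le by (intro sum.group finite_triangular_partitions) (fastforce intro: order_trans)+
  also have "\<dots> = (\<Sum>m=1..n. \<Sum>\<nu> | \<nu> \<in> triangular_partitions n \<and> sum_mset \<nu> = m. h \<nu>)"
  proof (intro sum.group[symmetric] finite_triangular_partitions)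
    show "sum_mset ` triangular_partitions n \<subseteq> {1..n}"
    proof
      fix m assume "m \<in> sum_mset ` triangular_partitions n"
      then obtain \<nu> where \<nu>: "\<nu> \<in> triangular_partitions n" "m = sum_mset \<nu>" by blast
      have "size \<nu> \<noteq> 0" using triangular_partitions_nonempty[OF \<nu>(1) assms] by simp
      hence "1 \<le> m" "m \<le> n" using triangular_partitions_size_le[OF \<nu>(1)] triangular_partitions_sum_le[OF \<nu>(1)] \<nu>(2) by linarith+
      thus "m \<in> {1..n}" by simp
    qed
  qed simp
  also have "\<dots> = (\<Sum>m=1..n. - (of_real (a_coeff n m) / of_nat m * \<zeta> ^ m))"
  proof (intro sum.cong refl)
    fix m assume m: "m \<in> {1..n}"
    have "(\<Sum>\<nu> | \<nu> \<in> triangular_partitions n \<and> sum_mset \<nu> = m. h \<nu>) =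
       (\<Sum>\<nu> | \<nu> \<in> triangular_partitions n \<and> sum_mset \<nu> = m. - (of_real ((-1) ^ (m + size \<nu>) * (real m / real (size \<nu>)) *
             card (permutations_of_multiset \<nu>)) / of_nat m * \<zeta> ^ m))"
    proof (intro sum.cong refl)
      fix \<nu> assume "\<nu> \<in> {\<nu>. \<nu> \<in> triangular_partitions n \<and> sum_mset \<nu> = m}"
      with triangular_partitions_nonempty[of \<nu> n] assms have \<nu>: "\<nu> \<noteq> {#}" "sum_mset \<nu> = m" by blast+
      \<comment> \<open>As \<nu> is nonempty, the exponent \<open>size \<nu> - 1\<close> in
        \<open>h\<close> is a true predecessor.\<close>
      then obtain s where s: "size \<nu> = Suc s" by (metis Suc_pred nonempty_has_size)
      show "h \<nu> = - (of_real ((-1) ^ (m + size \<nu>) * (real m / real (size \<nu>)) *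
             card (permutations_of_multiset \<nu>)) / of_nat m * \<zeta> ^ m)"
      proof -
        have "of_nat m \<noteq> (0::complex)" "of_nat (Suc s) \<noteq> (0::complex)"
          using m by (simp_all del: of_nat_Suc)
        thus ?thesis unfolding h_def s \<nu>(2)
          by (simp add: power_add field_simps power_minus[of \<zeta>] del: of_nat_Suc)
      qed
    qed
    thus "(\<Sum>\<nu> | \<nu> \<in> triangular_partitions n \<and> sum_mset \<nu> = m. h \<nu>) = - (of_real (a_coeff n m) / of_nat m * \<zeta> ^ m)"
      unfolding a_coeff_eq of_real_sum sum_divide_distrib sum_distrib_right sum_negf .
  qed
  finally show ?thesis by (simp add: log_coeff_def sum_negf)
qed

section \<open>The analytic logarithm\<close>

definition theta :: "complex \<Rightarrow> complex \<Rightarrow> complex" where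
  "theta \<zeta> q = eval_fps (theta_fps \<zeta>) q"

text \<open>The ratio of consecutive terms is A r^(n+1), which tends to 0 whatever A is; hence
  \<zeta> is unrestricted as long as |q| < 1.\<close>

lemma summable_theta_majorant:
  fixes A r :: real
  assumes "0 \<le> A" "0 \<le> r" "r < 1"
  shows "summable (\<lambda>n. A ^ n * r ^ tri n)"
proof -
  have "(\<lambda>n. A * r ^ Suc n) \<longlonglongrightarrow> A * 0"
    using assms by (intro tendsto_mult tendsto_const LIMSEQ_Suc LIMSEQ_power_zero) auto
  hence "eventually (\<lambda>n. A * r ^ Suc n < 1/2) sequentially"
    by (rule order_tendstoD) simp
  then obtain N where N: "\<And>n. n \<ge> N \<Longrightarrow> A * r ^ Suc n < 1/2"
    unfolding eventually_sequentially by blast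
  show ?thesis
  proof (rule summable_ratio_test[of "1/2" N])
    fix n assume n: "n \<ge> N"
    have nn: "0 \<le> A ^ n * r ^ tri n" using assms by simp
    have "A ^ Suc n * r ^ tri (Suc n) = (A * r ^ Suc n) * (A ^ n * r ^ tri n)"
      by (simp add: power_add algebra_simps)
    also have "\<dots> \<le> 1/2 * (A ^ n * r ^ tri n)"
      using N[OF n] nn by (intro mult_right_mono) auto
    finally show "norm (A ^ Suc n * r ^ tri (Suc n)) \<le> 1/2 * norm (A ^ n * r ^ tri n)"
      using assms by simp
  qed simp
qed

lemma summable_theta:
  fixes \<zeta> q :: complex
  assumes "norm q < 1"
  shows "summable (\<lambda>n. (-\<zeta>) ^ n * q ^ tri n)"
proof (rule summable_norm_cancel)
  show "summable (\<lambda>n. norm ((-\<zeta>) ^ n * q ^ tri n))"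
    using summable_theta_majorant[of "norm \<zeta>" "norm q"] assms by (simp add: norm_mult norm_power)
qed

lemma theta_fps_reindex:
  "(\<lambda>n. (-\<zeta>) ^ n * q ^ tri n) sums s \<longleftrightarrow> (\<lambda>t. theta_fps \<zeta> $ t * q ^ t) sums s" for \<zeta> q :: complex
  using sums_mono_reindex[OF strict_mono_tri, of "\<lambda>t. theta_fps \<zeta> $ t * q ^ t" s]
  by (simp add: theta_fps_def inv_f_f inj_tri)

lemma theta_sums:
  assumes "norm q < 1"
  shows "(\<lambda>n. (-\<zeta>) ^ n * q ^ tri n) sums theta \<zeta> q"
  using summable_sums[OF summable_theta[OF assms, of \<zeta>]] theta_fps_reindex[of \<zeta> q]
  unfolding theta_def eval_fps_def by (metis sums_unique)

lemma theta_conv_radius: "fps_conv_radius (theta_fps \<zeta>) \<ge> 1"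
  unfolding fps_conv_radius_def
proof (rule conv_radius_geI_ex')
  fix r :: real assume "0 < r" "ereal r < 1"
  hence "norm (of_real r :: complex) < 1" by (simp add: one_ereal_def)
  from summable_theta[OF this, of \<zeta>] show "summable (\<lambda>n. theta_fps \<zeta> $ n * of_real r ^ n)"
    using theta_fps_reindex by (meson summable_def)
qed

lemma theta_holomorphic: "theta \<zeta> holomorphic_on ball 0 1"
proof -
  have "ball 0 1 \<subseteq> eball (0::complex) (fps_conv_radius (theta_fps \<zeta>))"
    using theta_conv_radius[of \<zeta>] by (auto simp: eball_def one_ereal_def intro: less_le_trans[of "ereal _" "ereal 1"])
  thus ?thesis unfolding theta_def by (intro holomorphic_intros)
qed

lemma theta_has_fps_expansion: "theta \<zeta> has_fps_expansion theta_fps \<zeta>"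
proof -
  have "fps_conv_radius (theta_fps \<zeta>) > 0"
    by (rule less_le_trans[OF _ theta_conv_radius]) simp
  thus ?thesis unfolding theta_def by (rule eval_fps_has_fps_expansion)
qed

lemma theta_0 [simp]: "theta \<zeta> 0 = 1"
  by (simp add: theta_def eval_fps_at_0)

text \<open>Joint continuity, which holomorphy in q for each single \<zeta> does not give; the
  compactness argument in (w, q) rests on it.\<close>

lemma theta_continuous_on:
  fixes r A :: real
  assumes "r < 1"
  shows "continuous_on (cball 0 A \<times> cball 0 r) (\<lambda>p. theta (fst p) (snd p))"
proof (cases "0 \<le> A \<and> 0 \<le> r")
  case True
  let ?S = "cball 0 A \<times> cball 0 r :: (complex \<times> complex) set"
  let ?f = "\<lambda>n p. (-fst p) ^ n * snd p ^ tri n :: complex"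
  have "uniform_limit ?S (\<lambda>n p. \<Sum>i<n. ?f i p) (\<lambda>p. suminf (\<lambda>i. ?f i p)) sequentially"
  proof (rule Weierstrass_m_test)
    fix n p assume "p \<in> ?S"
    thus "norm (?f n p) \<le> A ^ n * r ^ tri n"
      using True by (auto simp: norm_mult norm_power intro!: mult_mono power_mono)
  qed (use summable_theta_majorant True assms in auto)
  moreover have "suminf (\<lambda>i. ?f i p) = theta (fst p) (snd p)" if "p \<in> ?S" for p
    using theta_sums[of "snd p" "fst p"] that assms by (auto simp: sums_iff)
  ultimately have "uniform_limit ?S (\<lambda>n p. \<Sum>i<n. ?f i p) (\<lambda>p. theta (fst p) (snd p)) sequentially"
    by (subst uniform_limit_cong'[where g = "\<lambda>n p. \<Sum>i<n. ?f i p" and i = "\<lambda>p. suminf (\<lambda>i. ?f i p)"]) auto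
  thus ?thesis
    by (rule uniform_limit_theorem[rotated]) (auto intro!: always_eventually continuous_intros)
qed (auto simp: cball_eq_empty Sigma_empty1 not_le)

section \<open>Formal versus analytic logarithms\<close>

lemma fps_log_unique:
  fixes E P :: "complex fps"
  assumes "fps_deriv E * P = fps_deriv P" "E $ 0 = 0" "P $ 0 = 1"
  shows "E = fps_ln 1 oo (P - 1)"
proof -
  let ?D = "fps_ln 1 oo (P - 1)"
  have "fps_deriv ?D = (inverse (1 + fps_X) oo (P - 1)) * fps_deriv P"
    using assms by (subst fps_compose_deriv) (auto simp: fps_ln_deriv)
  also have "inverse (1 + fps_X) oo (P - 1) = inverse P"
    using assms by (subst fps_inverse_compose) (auto simp: fps_compose_add_distrib)
  finally have "fps_deriv ?D * P = fps_deriv P"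
    using assms inverse_mult_eq_1'[of P] by (simp add: mult_ac)
  with assms(1) have "fps_deriv E * P = fps_deriv ?D * P" by simp
  moreover have "P \<noteq> 0" using assms by auto
  ultimately have "fps_deriv E = fps_deriv ?D" by simp
  thus ?thesis using assms(2) by (simp add: fps_deriv_eq_iff)
qed

text \<open>Differentiating exp L = \<theta> gives L' \<theta> = \<theta>', an identity of power
  series that, together with L(0) = 0, determines the formal logarithm.\<close>

lemma log_theta_has_fps_expansion:
  assumes R: "R > 0" and L: "L holomorphic_on ball 0 R" "L 0 = 0"
    and exp_L: "\<And>q. q \<in> ball 0 R \<Longrightarrow> exp (L q) = theta \<zeta> q"
  shows "L has_fps_expansion (fps_ln 1 oo (theta_fps \<zeta> - 1))"
proof -
  define E where "E = fps_expansion L 0"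
  have E: "L has_fps_expansion E"
    unfolding E_def using R L by (intro has_fps_expansion_fps_expansion[of "ball 0 R"]) auto
  have "(\<lambda>q. deriv L q * theta \<zeta> q) has_fps_expansion (fps_deriv E * theta_fps \<zeta>)"
    by (intro fps_expansion_intros E theta_has_fps_expansion)
  moreover have "eventually (\<lambda>q. deriv L q * theta \<zeta> q = deriv (theta \<zeta>) q) (nhds 0)"
  proof -
    have "eventually (\<lambda>q. q \<in> ball 0 R) (nhds 0)"
      using R by (intro eventually_nhds_in_open) auto
    thus ?thesis
    proof eventually_elim
      case (elim q)
      have "eventually (\<lambda>q. q \<in> ball 0 R) (nhds q)"
        using elim by (intro eventually_nhds_in_open) auto
      hence "eventually (\<lambda>q. theta \<zeta> q = exp (L q)) (nhds q)"
        by eventually_elim (simp add: exp_L)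
      hence "deriv (theta \<zeta>) q = deriv (\<lambda>q. exp (L q)) q" by (intro deriv_cong_ev) auto
      also have "(L has_field_derivative deriv L q) (at q)"
        using holomorphic_derivI[OF L(1) open_ball elim] .
      hence "deriv (\<lambda>q. exp (L q)) q = exp (L q) * deriv L q"
        by (intro DERIV_imp_deriv) (auto intro!: derivative_eq_intros)
      finally show ?case using elim by (simp add: exp_L)
    qed
  qed
  ultimately have "deriv (theta \<zeta>) has_fps_expansion (fps_deriv E * theta_fps \<zeta>)"
    by (rule has_fps_expansion_cong[OF _ refl, THEN iffD1, rotated])
  moreover have "deriv (theta \<zeta>) has_fps_expansion fps_deriv (theta_fps \<zeta>)"
    by (intro fps_expansion_intros theta_has_fps_expansion)
  ultimately have "fps_deriv E * theta_fps \<zeta> = fps_deriv (theta_fps \<zeta>)"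
    by (rule fps_expansion_unique_complex)
  moreover have "E $ 0 = 0" using has_fps_expansion_imp_0_eq_fps_nth_0[OF E] L by simp
  ultimately have "E = fps_ln 1 oo (theta_fps \<zeta> - 1)" by (intro fps_log_unique) auto
  with E show ?thesis by simp
qed

text \<open>Differentiate and cancel the nonzero series exp B; the vanishing constant terms settle
  the constant of integration. This is what makes the g_k unique.\<close>

lemma exp_compose_cancel:
  fixes A B :: "complex fps"
  assumes "fps_exp 1 oo A = fps_exp 1 oo B" "A $ 0 = 0" "B $ 0 = 0"
  shows "A = B"
proof -
  have d: "fps_deriv (fps_exp 1 oo C) = (fps_exp 1 oo C) * fps_deriv C" if "C $ 0 = 0" for C :: "complex fps"
    using that by (simp add: fps_compose_deriv)
  have "(fps_exp 1 oo B) * fps_deriv A = (fps_exp 1 oo B) * fps_deriv B"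
    using d[of A] d[of B] assms by metis
  moreover have "(fps_exp 1 oo B) $ 0 = 1" by simp
  hence "fps_exp 1 oo B \<noteq> 0" by (metis fps_zero_nth zero_neq_one)
  ultimately have "fps_deriv A = fps_deriv B" by simp
  thus ?thesis using assms by (simp add: fps_deriv_eq_iff)
qed

section \<open>Zero-free neighbourhoods and bounded logarithms\<close>

lemma cball_shrink:
  fixes q :: "'a::real_normed_vector"
  assumes "0 \<le> r" "0 \<le> d" "norm q \<le> r + d"
  shows "\<exists>q'\<in>cball 0 r. norm (q - q') \<le> d"
proof (cases "norm q \<le> r")
  case True
  thus ?thesis using assms by (intro bexI[of _ q]) auto
next
  case False
  let ?q = "(r / norm q) *\<^sub>R q"
  have "q \<noteq> 0" using False assms by auto
  have "q - ?q = (1 - r / norm q) *\<^sub>R q" by (simp add: scaleR_diff_left)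
  hence "norm (q - ?q) = \<bar>1 - r / norm q\<bar> * norm q" by simp
  also have "1 - r / norm q \<ge> 0" using False assms by (simp add: divide_le_eq)
  hence "\<bar>1 - r / norm q\<bar> * norm q = norm q - r" using \<open>q \<noteq> 0\<close> by (simp add: left_diff_distrib)
  finally have "norm (q - ?q) \<le> d" using assms by simp
  moreover have "?q \<in> cball 0 r" using False assms by auto
  ultimately show ?thesis by blast
qed

text \<open>The zero set of $\theta$ is closed and misses the compact set $\{1\} \times \overline{B}(0, r_0)$.\<close>

lemma theta_nonzero_nearby:
  fixes r0 :: real
  assumes r0: "0 \<le> r0" "r0 < 1" and nz: "\<forall>q. norm q \<le> r0 \<longrightarrow> theta 1 q \<noteq> 0"
  shows "\<exists>\<delta>>0. r0 + \<delta> < 1 \<and>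
    (\<forall>w q. norm w \<le> \<delta> \<longrightarrow> norm q \<le> r0 + \<delta> \<longrightarrow> theta (exp w) q \<noteq> 0) \<and>
    continuous_on (cball 0 \<delta> \<times> cball 0 (r0 + \<delta>)) (\<lambda>p. theta (exp (fst p)) (snd p))"
proof -
  \<comment> \<open>Any radius strictly between r0 and 1 would do: it leaves room around the disc
    while the majorant still converges.\<close>
  define r1 where "r1 = (1 + r0) / 2"
  have r1: "r0 < r1" "r1 < 1" using r0 by (auto simp: r1_def)
  define \<Phi> where "\<Phi> p = theta (exp (fst p)) (snd p)" for p :: "complex \<times> complex"
  let ?U = "ball 0 1 \<times> ball 0 r1 :: (complex \<times> complex) set"
  have "continuous_on ?U (\<lambda>p. (\<lambda>p. theta (fst p) (snd p)) (exp (fst p), snd p))"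
  proof (rule continuous_on_compose2[OF theta_continuous_on[OF r1(2), of "exp 1"]])
    show "(\<lambda>p. (exp (fst p), snd p)) ` ?U \<subseteq> cball 0 (exp 1) \<times> cball 0 r1"
    proof safe
      fix w q :: complex assume "w \<in> ball 0 1" "q \<in> ball 0 r1"
      have "norm (exp w) \<le> exp (norm w)" by (rule norm_exp)
      also have "\<dots> \<le> exp 1" using \<open>w \<in> ball 0 1\<close> by simp
      finally show "exp (fst (w, q)) \<in> cball 0 (exp 1)" by simp
      show "snd (w, q) \<in> cball 0 r1" using \<open>q \<in> ball 0 r1\<close> by simp
    qed
  qed (intro continuous_intros)
  hence cont: "continuous_on ?U \<Phi>" by (simp add: \<Phi>_def)
  have "open ?U" by (intro open_Times open_ball)
  let ?B = "?U \<inter> \<Phi> -` (- {0})"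
  have openB: "open ?B"
    by (rule continuous_open_preimage[OF cont \<open>open ?U\<close>]) auto
  have cpt: "compact ({0} \<times> cball 0 r0 :: (complex \<times> complex) set)"
    by (intro compact_Times) auto
  have sub: "{0} \<times> cball 0 r0 \<subseteq> ?B"
    using r1 nz by (auto simp: \<Phi>_def)
  obtain \<epsilon> where \<epsilon>: "\<epsilon> > 0" "(\<Union>x\<in>{0} \<times> cball 0 r0. ball x \<epsilon>) \<subseteq> ?B"
    by (rule compact_subset_open_imp_ball_epsilon_subset[OF cpt openB sub])
  \<comment> \<open>Both coordinates may move by \<delta>, so 2 \<delta> has to stay below
    \<epsilon>; the second bound keeps r0 + \<delta> below 1.\<close>
  define \<delta> where "\<delta> = min (\<epsilon> / 3) ((1 - r0) / 2)"
  have \<delta>: "\<delta> > 0" "2 * \<delta> < \<epsilon>" "r0 + \<delta> < 1" using \<epsilon>(1) r0 by (auto simp: \<delta>_def min_def field_simps)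
  have main: "(w, q) \<in> ?B" if wq: "norm w \<le> \<delta>" "norm q \<le> r0 + \<delta>" for w q
  proof -
    obtain q' where q': "q' \<in> cball 0 r0" "norm (q - q') \<le> \<delta>"
      using cball_shrink[of r0 \<delta> q] r0 \<delta> wq by auto
    have "dist (0, q') (w, q) \<le> dist 0 w + dist q' q"
      unfolding dist_Pair_Pair by (rule sqrt_sum_squares_le_sum) auto
    also have "\<dots> < \<epsilon>" using wq q' \<delta> by (simp add: dist_norm norm_minus_commute)
    finally show ?thesis using \<epsilon>(2) q' by (meson UN_I mem_ball mem_Times_iff SigmaI singletonI subsetD)
  qed
  show ?thesis
  proof (intro exI[of _ \<delta>] conjI allI impI)
    show "theta (exp w) q \<noteq> 0" if "norm w \<le> \<delta>" "norm q \<le> r0 + \<delta>" for w q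
      using main[OF that] by (simp add: \<Phi>_def)
    have "cball 0 \<delta> \<times> cball 0 (r0 + \<delta>) \<subseteq> ?U" using main by auto
    thus "continuous_on (cball 0 \<delta> \<times> cball 0 (r0 + \<delta>)) (\<lambda>p. theta (exp (fst p)) (snd p))"
      using continuous_on_subset[OF cont] unfolding \<Phi>_def by blast
  qed (use \<delta> in auto)
qed

text \<open>Cauchy's inequality on circles of radius d gives |f'| \<le> K / d, hence |L'| = |f' / f|
  \<le> K / d / c. The mean value inequality from 0 then bounds L on the disc of radius r.\<close>

lemma holomorphic_log_bounded:
  fixes f :: "complex \<Rightarrow> complex"
  assumes r: "0 < r" and d: "0 < d" and c: "0 < c"
    and f: "f holomorphic_on ball 0 (r + d)" "f 0 = 1"
    and bounds: "\<And>q. norm q < r + d \<Longrightarrow> norm (f q) \<le> K" "\<And>q. norm q < r + d \<Longrightarrow> c \<le> norm (f q)"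
  shows "\<exists>L. L holomorphic_on ball 0 r \<and> L 0 = 0 \<and>
    (\<forall>q\<in>ball 0 r. exp (L q) = f q \<and> norm (L q) \<le> K / d / c * r)"
proof -
  have hol: "f holomorphic_on ball 0 r" by (rule holomorphic_on_subset[OF f(1)]) (use d in auto)
  have nz: "f q \<noteq> 0" if "q \<in> ball 0 r" for q
    using bounds(2)[of q] c d that by auto
  obtain g where g: "g holomorphic_on ball 0 r" "\<And>q. q \<in> ball 0 r \<Longrightarrow> exp (g q) = f q"
    by (rule holomorphic_logarithm_exists[OF convex_ball open_ball hol nz, of 0]) (use r in auto)
  \<comment> \<open>Subtracting g(0) fixes the branch with L(0) = 0; it does not change the
    exponential, because exp(g(0)) = f(0) = 1.\<close>
  define L where "L q = g q - g 0" for q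
  have L: "L holomorphic_on ball 0 r" unfolding L_def by (intro holomorphic_intros g)
  have exp_g0: "exp (g 0) = 1" using g(2)[of 0] r f(2) by simp
  have exp_L: "exp (L q) = f q" if "q \<in> ball 0 r" for q
    using g(2)[OF that] exp_g0 by (simp add: L_def exp_diff)
  have dL: "norm (deriv L q) \<le> K / d / c" if q: "q \<in> ball 0 r" for q
  proof -
    have sub: "cball q d \<subseteq> ball 0 (r + d)"
    proof
      fix x assume "x \<in> cball q d"
      with q norm_triangle_ineq[of q "x - q"] show "x \<in> ball 0 (r + d)"
        by (simp add: dist_norm norm_minus_commute)
    qed
    have "norm ((deriv ^^ 1) f q) \<le> fact 1 * K / d ^ 1"
    proof (rule Cauchy_inequality[OF _ _ d])
      show "f holomorphic_on ball q d"
        using sub ball_subset_cball by (intro holomorphic_on_subset[OF f(1)]) blast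
      show "continuous_on (cball q d) f"
        by (intro holomorphic_on_imp_continuous_on holomorphic_on_subset[OF f(1) sub])
      fix x assume "norm (q - x) = d"
      hence "x \<in> ball 0 (r + d)" using sub by (auto simp: dist_norm)
      thus "norm (f x) \<le> K" by (intro bounds) simp
    qed
    hence 1: "norm (deriv f q) \<le> K / d" by simp
    have "eventually (\<lambda>q. q \<in> ball 0 r) (nhds q)"
      using q by (intro eventually_nhds_in_open) auto
    hence "eventually (\<lambda>q. f q = exp (L q)) (nhds q)" by eventually_elim (simp add: exp_L)
    hence "deriv f q = deriv (\<lambda>q. exp (L q)) q" by (intro deriv_cong_ev) auto
    also have "(L has_field_derivative deriv L q) (at q)"
      using holomorphic_derivI[OF L open_ball q] .
    hence "deriv (\<lambda>q. exp (L q)) q = exp (L q) * deriv L q"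
      by (intro DERIV_imp_deriv) (auto intro!: derivative_eq_intros)
    finally have "deriv L q = deriv f q / f q" using nz[OF q] exp_L[OF q] by (simp add: field_simps)
    moreover have "c \<le> norm (f q)" using bounds(2)[of q] q d by simp
    ultimately show ?thesis using 1 c
      by (simp only: norm_divide) (intro frac_le order_trans[OF norm_ge_zero 1], auto)
  qed
  have "norm (L q) \<le> K / d / c * r" if q: "q \<in> ball 0 r" for q
  proof -
    have "norm (L q - L 0) \<le> K / d / c * norm (q - 0)"
    proof (rule field_differentiable_bound[OF convex_ball[of 0 r]])
      fix z assume "z \<in> ball (0::complex) r"
      thus "(L has_field_derivative deriv L z) (at z within ball 0 r)"
        using holomorphic_derivI[OF L open_ball] has_field_derivative_at_within by blast
    qed (use dL q r in auto)
    also have "\<dots> \<le> K / d / c * r"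
      using q order_trans[OF norm_ge_zero dL[OF q]] by (intro mult_left_mono) auto
    finally show ?thesis by (simp add: L_def)
  qed
  moreover have "L 0 = 0" by (simp add: L_def)
  ultimately show ?thesis using L exp_L by blast
qed

text \<open>The order of the quantifiers is the point: R and C serve all small w at once, so C / R^n
  can be fed into Cauchy's inequality in w. Compactness supplies the common bounds K and c on
  |\<theta>|.\<close>

lemma theta_log_expansion:
  fixes r0 :: real
  assumes r0: "0 < r0" "r0 < 1" and nz: "\<forall>q. norm q \<le> r0 \<longrightarrow> theta 1 q \<noteq> 0"
  shows "\<exists>\<rho>>0. \<exists>R>r0. \<exists>C. \<forall>w. norm w \<le> \<rho> \<longrightarrow>
    (\<forall>n. norm (log_coeff n (exp w)) \<le> C / R ^ n) \<and>
    (\<forall>q. norm q < R \<longrightarrow>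
       (\<exists>s. (\<lambda>n. log_coeff n (exp w) * q ^ n) sums s \<and> theta (exp w) q = exp (- s)))"
proof -
  obtain \<delta> where \<delta>: "\<delta> > 0" "r0 + \<delta> < 1"
    and nz': "\<And>w q. norm w \<le> \<delta> \<Longrightarrow> norm q \<le> r0 + \<delta> \<Longrightarrow> theta (exp w) q \<noteq> 0"
    and cont: "continuous_on (cball 0 \<delta> \<times> cball 0 (r0 + \<delta>)) (\<lambda>p. theta (exp (fst p)) (snd p))"
    using theta_nonzero_nearby[OF less_imp_le[OF r0(1)] r0(2) nz] by blast
  define \<Phi> where "\<Phi> p = theta (exp (fst p)) (snd p)" for p :: "complex \<times> complex"
  let ?S = "cball 0 \<delta> \<times> cball 0 (r0 + \<delta>) :: (complex \<times> complex) set"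
  have cpt: "compact ?S" by (intro compact_Times) auto
  have contn: "continuous_on ?S (\<lambda>p. norm (\<Phi> p))"
    using cont unfolding \<Phi>_def by (rule continuous_on_norm)
  have ne: "?S \<noteq> {}" using \<delta> r0 by auto
  obtain K where K: "\<And>p. p \<in> ?S \<Longrightarrow> norm (\<Phi> p) \<le> K"
    using continuous_attains_sup[OF cpt ne contn] by blast
  obtain p0 where p0: "p0 \<in> ?S" "\<And>p. p \<in> ?S \<Longrightarrow> norm (\<Phi> p0) \<le> norm (\<Phi> p)"
    using continuous_attains_inf[OF cpt ne contn] by blast
  define c where "c = norm (\<Phi> p0)"
  have c: "c > 0" using nz'[of "fst p0" "snd p0"] p0(1) by (auto simp: c_def \<Phi>_def mem_Times_iff)
  \<comment> \<open>Three margins of width d: \<theta> is bounded above and below up to r0 + 3 d =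
    r0 + \<delta>, its logarithm is bounded on the disc of radius r0 + 2 d, and the coefficients are
    estimated on the circle of radius R = r0 + d.\<close>
  define d where "d = \<delta> / 3"
  define R where "R = r0 + d"
  define C where "C = K / d / c * (r0 + 2 * d)"
  have d: "d > 0" "\<delta> = 3 * d" using \<delta> by (auto simp: d_def)
  have ex: "\<exists>L. L holomorphic_on ball 0 (r0 + 2 * d) \<and> L 0 = 0 \<and>
      (\<forall>q\<in>ball 0 (r0 + 2 * d). exp (L q) = theta (exp w) q \<and> norm (L q) \<le> C)" if w: "norm w \<le> \<delta>" for w
  proof -
    have 1: "theta (exp w) holomorphic_on ball 0 (r0 + 2 * d + d)"
      by (rule holomorphic_on_subset[OF theta_holomorphic]) (use d \<delta> in auto)
    have 2: "norm (theta (exp w) q) \<le> K" "c \<le> norm (theta (exp w) q)"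
      if "norm q < r0 + 2 * d + d" for q
      using K[of "(w, q)"] p0(2)[of "(w, q)"] w d that by (auto simp: \<Phi>_def c_def)
    have "r0 + 2 * d > 0" using r0 d by simp
    from holomorphic_log_bounded[OF this d(1) c 1 theta_0 2] show ?thesis
      unfolding C_def .
  qed
  have E: "norm (log_coeff n (exp w)) \<le> C / R ^ n"
    "norm q < R \<Longrightarrow> \<exists>s. (\<lambda>n. log_coeff n (exp w) * q ^ n) sums s \<and> theta (exp w) q = exp (- s)"
    if w: "norm w \<le> \<delta>" for w q n
  proof -
    let ?r = "r0 + 2 * d"
    let ?E = "fps_ln 1 oo (theta_fps (exp w) - 1)"
    obtain L where L: "L holomorphic_on ball 0 ?r" "L 0 = 0"
      "\<And>q. q \<in> ball 0 ?r \<Longrightarrow> exp (L q) = theta (exp w) q"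
      "\<And>q. q \<in> ball 0 ?r \<Longrightarrow> norm (L q) \<le> C"
      using ex[OF w] by blast
    have R: "0 < R" "R < ?r" using r0 d by (auto simp: R_def)
    have E: "L has_fps_expansion ?E"
      by (rule log_theta_has_fps_expansion[OF _ L(1-3)]) (use R in auto)
    \<comment> \<open>At n = 0 both sides vanish: the formal logarithm has no constant term and the
      sum in \<open>log_coeff\<close> is empty.\<close>
    have coeff: "?E $ n = - log_coeff n (exp w)" for n
      using fps_ln_theta_nth[of n "exp w"] by (cases "n = 0") (simp_all add: log_coeff_def)
    have "norm ((deriv ^^ n) L 0) \<le> fact n * C / R ^ n"
      using R by (intro Cauchy_inequality holomorphic_on_imp_continuous_on L(4) holomorphic_on_subset[OF L(1)]) auto
    hence "norm (?E $ n) \<le> C / R ^ n"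
      unfolding fps_nth_fps_expansion[OF E] by (simp add: norm_divide field_simps)
    thus "norm (log_coeff n (exp w)) \<le> C / R ^ n" by (simp add: coeff)
    show "\<exists>s. (\<lambda>n. log_coeff n (exp w) * q ^ n) sums s \<and> theta (exp w) q = exp (- s)" if q: "norm q < R"
    proof -
      have "L holomorphic_on eball 0 (ereal ?r)" using L(1) by simp
      from has_fps_expansion_imp_sums_complex[OF E this, of q] q R
      have "(\<lambda>n. ?E $ n * q ^ n) sums L q" by simp
      hence "(\<lambda>n. log_coeff n (exp w) * q ^ n) sums (- L q)"
        unfolding coeff using sums_minus by fastforce
      moreover have "exp (L q) = theta (exp w) q" using q R by (intro L(3)) auto
      ultimately show ?thesis by (intro exI[of _ "- L q"]) auto
    qed
  qed
  have "R > r0" using d by (simp add: R_def)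
  with \<delta>(1) E show ?thesis by blast
qed

section \<open>Expansion in both variables\<close>

text \<open>These are k! times the Taylor coefficients in w of \<open>log_coeff n (exp w)\<close>.
  The form m^k / m, instead of m^(k-1), lets k = 0 cover the exponent of T_0, where natural
  subtraction would lose the denominator.\<close>

definition moment :: "nat \<Rightarrow> nat \<Rightarrow> complex" where
  "moment k n = (\<Sum>m=1..n. of_real (a_coeff n m) / of_nat m * of_nat m ^ k)"

lemma moment_at_0 [simp]: "moment k 0 = 0"
  by (simp add: moment_def)

lemma moment_zeroth: "moment 0 n = (\<Sum>m=1..n. of_real (a_coeff n m) / of_nat m)"
  by (simp add: moment_def)

lemma moment_pos: "k \<ge> 1 \<Longrightarrow> moment k n = (\<Sum>m=1..n. of_real (a_coeff n m) * of_nat m ^ (k - 1))"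
  unfolding moment_def by (intro sum.cong refl) (cases k; simp)

lemma log_coeff_exp_sums: "(\<lambda>k. moment k n / fact k * w ^ k) sums log_coeff n (exp w)"
proof -
  have "(\<lambda>k. \<Sum>m=1..n. of_real (a_coeff n m) / of_nat m * ((of_nat m * w) ^ k /\<^sub>R fact k)) sums
      (\<Sum>m=1..n. of_real (a_coeff n m) / of_nat m * exp (of_nat m * w))"
    by (intro sums_sum sums_mult exp_converges)
  also have "(\<Sum>m=1..n. of_real (a_coeff n m) / of_nat m * exp (of_nat m * w)) = log_coeff n (exp w)"
    by (simp add: log_coeff_def exp_of_nat_mult)
  also have "(\<lambda>k. \<Sum>m=1..n. of_real (a_coeff n m) / of_nat m * ((of_nat m * w) ^ k /\<^sub>R fact k)) =
      (\<lambda>k. moment k n / fact k * w ^ k)"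
    by (intro ext) (simp add: moment_def sum_divide_distrib sum_distrib_right sum_distrib_left power_mult_distrib
      scaleR_conv_of_real field_simps)
  finally show ?thesis .
qed

lemma log_coeff_exp_has_fps_expansion:
  "(\<lambda>w. log_coeff n (exp w)) has_fps_expansion Abs_fps (\<lambda>k. moment k n / fact k)"
  by (rule has_fps_expansionI, rule always_eventually) (use log_coeff_exp_sums[of n] in simp)

text \<open>A finite combination of exponentials e^(mw) is entire in w, so Cauchy's inequality
  applies on the circle of radius \<rho>.\<close>

lemma norm_moment_le:
  assumes \<rho>: "\<rho> > 0" and bound: "\<And>w. norm w \<le> \<rho> \<Longrightarrow> norm (log_coeff n (exp w)) \<le> B"
  shows "norm (moment k n / fact k) \<le> B / \<rho> ^ k"
proof -
  have hol: "(\<lambda>w. log_coeff n (exp w)) holomorphic_on A" for A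
    unfolding log_coeff_def by (intro holomorphic_intros) auto
  have "norm ((deriv ^^ k) (\<lambda>w. log_coeff n (exp w)) 0) \<le> fact k * B / \<rho> ^ k"
    using \<rho> by (intro Cauchy_inequality holomorphic_on_imp_continuous_on hol bound) auto
  moreover have "moment k n / fact k = (deriv ^^ k) (\<lambda>w. log_coeff n (exp w)) 0 / fact k"
    using fps_nth_fps_expansion[OF log_coeff_exp_has_fps_expansion, of n k] by simp
  ultimately show ?thesis by (simp add: norm_divide field_simps)
qed

lemma double_geometric_abs_summable:
  fixes F :: "nat \<times> nat \<Rightarrow> complex" and x y :: real
  assumes "0 \<le> x" "x < 1" "0 \<le> y" "y < 1"
    and le: "\<And>n k. norm (F (n, k)) \<le> C * x ^ n * y ^ k"
  shows "F summable_on UNIV \<times> UNIV"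
proof -
  have geo: "((\<lambda>k. z ^ k) has_sum (1 / (1 - z))) UNIV" if "0 \<le> z" "z < 1" for z :: real
    using that by (intro sums_nonneg_imp_has_sum geometric_sums) auto
  have "(\<lambda>(n, k). x ^ n * y ^ k) summable_on UNIV \<times> UNIV"
  proof (rule summable_on_SigmaI)
    show "((\<lambda>k. case (n, k) of (n, k) \<Rightarrow> x ^ n * y ^ k) has_sum (x ^ n * (1 / (1 - y)))) UNIV" for n
      using has_sum_cmult_right[OF geo[of y]] assms by simp
    show "(\<lambda>n. x ^ n * (1 / (1 - y))) summable_on UNIV"
      using assms by (intro summable_on_cmult_left has_sum_imp_summable[OF geo])
  qed (use assms in auto)
  hence "(\<lambda>p. C * (case p of (n, k) \<Rightarrow> x ^ n * y ^ k)) summable_on UNIV \<times> UNIV"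
    by (rule summable_on_cmult_right)
  hence "(\<lambda>p. norm (F p)) summable_on UNIV \<times> UNIV"
    by (rule Infinite_Sum.abs_summable_on_comparison_test') (use le in \<open>auto simp: mult.assoc\<close>)
  thus ?thesis by (rule abs_summable_summable)
qed

text \<open>One absolutely convergent double series is summed in both orders: over k first it gives
  -log \<theta>(e^w, q), over n first a power series in w. The strict inequality R > |q| makes it
  geometric in n.\<close>

lemma theta_expansion:
  fixes q :: complex
  assumes q: "0 < norm q" "norm q < 1" and nz: "\<forall>q'. norm q' \<le> norm q \<longrightarrow> theta 1 q' \<noteq> 0"
  shows "(\<lambda>n. moment k n * q ^ n) summable_on UNIV"
    and "\<exists>\<rho>>0. \<forall>w. norm w < \<rho> \<longrightarrow>
      (\<exists>s. ((\<lambda>k. infsum (\<lambda>n. moment k n * q ^ n) UNIV * w ^ k / fact k) has_sum s) UNIV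
        \<and> theta (exp w) q = exp (- s))"
proof -
  obtain \<rho> R C where \<rho>: "\<rho> > 0" and R: "R > norm q"
    and *: "\<forall>w. norm w \<le> \<rho> \<longrightarrow> (\<forall>n. norm (log_coeff n (exp w)) \<le> C / R ^ n) \<and>
      (\<forall>q. norm q < R \<longrightarrow>
         (\<exists>s. (\<lambda>n. log_coeff n (exp w) * q ^ n) sums s \<and> theta (exp w) q = exp (- s)))"
    using theta_log_expansion[OF q nz] by (elim exE conjE)
  have bound: "norm (log_coeff n (exp w)) \<le> C / R ^ n" if "norm w \<le> \<rho>" for w n
    using * that by simp
  have sums: "\<exists>s. (\<lambda>n. log_coeff n (exp w) * q ^ n) sums s \<and> theta (exp w) q = exp (- s)"
    if "norm w \<le> \<rho>" for w
    using * that R by simp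
  have R0: "R > 0" using R q by linarith
  define F where "F w = (\<lambda>(n, k). moment k n / fact k * w ^ k * q ^ n)" for w
  have F: "F w summable_on UNIV \<times> UNIV" if w: "norm w < \<rho>" for w
  proof (rule double_geometric_abs_summable)
    fix n k
    have "norm (F w (n, k)) = norm (moment k n / fact k) * norm w ^ k * norm q ^ n"
      by (simp add: F_def norm_mult norm_power norm_divide)
    also have "\<dots> \<le> (C / R ^ n / \<rho> ^ k) * norm w ^ k * norm q ^ n"
      by (intro mult_right_mono norm_moment_le \<rho> bound) auto
    also have "\<dots> = C * (norm q / R) ^ n * (norm w / \<rho>) ^ k"
      by (simp add: power_divide)
    finally show "norm (F w (n, k)) \<le> C * (norm q / R) ^ n * (norm w / \<rho>) ^ k" .
  qed (use R R0 \<rho> w in auto)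
  have col: "(\<lambda>n. F w (n, k)) summable_on UNIV" if "norm w < \<rho>" for w k
  proof -
    have "(\<lambda>(k, n). F w (n, k)) summable_on UNIV \<times> UNIV"
      using F[OF that] summable_on_swap[of "F w" UNIV UNIV] by simp
    thus ?thesis by (rule summable_on_SigmaD1) auto
  qed
  have mom: "(\<lambda>n. moment k n * q ^ n) summable_on UNIV" for k
  proof -
    \<comment> \<open>Any nonzero w within the radius serves: dividing the k-th column of
      \<open>F w\<close> by w^k / k! leaves the moments.\<close>
    define w where "w = (of_real (\<rho> / 2) :: complex)"
    have w: "norm w < \<rho>" "w \<noteq> 0" using \<rho> by (auto simp: w_def)
    have "(\<lambda>n. (fact k / w ^ k) * F w (n, k)) summable_on UNIV"
      by (intro summable_on_cmult_right col w)
    thus ?thesis using w by (simp add: F_def)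
  qed
  have "\<exists>s. ((\<lambda>k. infsum (\<lambda>n. moment k n * q ^ n) UNIV * w ^ k / fact k) has_sum s) UNIV
        \<and> theta (exp w) q = exp (- s)" if w: "norm w < \<rho>" for w
  proof -
    define S where "S = infsum (F w) (UNIV \<times> UNIV)"
    have S: "(F w has_sum S) (UNIV \<times> UNIV)" unfolding S_def by (rule has_sum_infsum[OF F[OF w]])
    have "((\<lambda>n. log_coeff n (exp w) * q ^ n) has_sum S) UNIV"
    proof (rule has_sum_SigmaD[OF S])
      fix n
      have "(\<lambda>k. F w (n, k)) summable_on UNIV"
        using summable_on_SigmaD1[of "\<lambda>n k. F w (n, k)" UNIV "\<lambda>_. UNIV" n] F[OF w] by simp
      then obtain t where t: "((\<lambda>k. F w (n, k)) has_sum t) UNIV" by (auto simp: summable_on_def)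
      moreover have "(\<lambda>k. F w (n, k)) sums (log_coeff n (exp w) * q ^ n)"
        using sums_mult2[OF log_coeff_exp_sums[of n w], of "q ^ n"] by (simp add: F_def)
      ultimately show "((\<lambda>k. F w (n, k)) has_sum (log_coeff n (exp w) * q ^ n)) UNIV"
        using has_sum_imp_sums sums_unique2 by blast
    qed
    hence "(\<lambda>n. log_coeff n (exp w) * q ^ n) sums S" by (rule has_sum_imp_sums)
    with sums[of w] w have "theta (exp w) q = exp (- S)" using sums_unique2 by fastforce
    moreover have "((\<lambda>k. infsum (\<lambda>n. moment k n * q ^ n) UNIV * w ^ k / fact k) has_sum S) UNIV"
    proof (rule has_sum_SigmaD)
      show "((\<lambda>(k, n). F w (n, k)) has_sum S) (UNIV \<times> UNIV)"
        using S has_sum_swap[of "F w" UNIV UNIV S] by simp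
      fix k
      show "((\<lambda>n. case (k, n) of (k, n) \<Rightarrow> F w (n, k)) has_sum
          (infsum (\<lambda>n. moment k n * q ^ n) UNIV * w ^ k / fact k)) UNIV"
        using has_sum_cmult_left[OF has_sum_infsum[OF mom[of k]], of "w ^ k / fact k"]
        by (simp add: F_def mult_ac)
    qed
    ultimately show ?thesis by blast
  qed
  with \<rho> show "\<exists>\<rho>>0. \<forall>w. norm w < \<rho> \<longrightarrow>
      (\<exists>s. ((\<lambda>k. infsum (\<lambda>n. moment k n * q ^ n) UNIV * w ^ k / fact k) has_sum s) UNIV
        \<and> theta (exp w) q = exp (- s))" by blast
  show "(\<lambda>n. moment k n * q ^ n) summable_on UNIV" by (rule mom)
qed

section \<open>Return to the partial theta function and the expansion domain\<close>

lemma epow_add: "epow w (r + s) = epow w r * epow w s"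
  by (simp add: epow_def algebra_simps exp_add)

lemma epow_of_nat: "epow w (real n) = epow w 1 ^ n"
  by (simp add: epow_def flip: exp_of_nat_mult) (simp add: algebra_simps)

lemma epow_nonzero [simp]: "epow w r \<noteq> 0"
  by (simp add: epow_def)

lemma epow_0_left [simp]: "epow 0 r = 1"
  by (simp add: epow_def)

lemma norm_epow_1: "norm (epow \<tau> 1) = exp (- 2 * pi * Im \<tau>)"
  by (simp add: epow_def norm_exp_eq_Re)

lemma norm_epow_1_less_1: "Im \<tau> > 0 \<Longrightarrow> norm (epow \<tau> 1) < 1"
  by (simp add: norm_epow_1)

text \<open>The exponent (n + 1/2)^2 / 2 equals n(n+1)/2 + 1/8, so q^(1/8) and \<zeta>^(1/2) factor
  out of every term.\<close>

lemma partial_theta_eq: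
  assumes "Im \<tau> > 0"
  shows "partial_theta z \<tau> = 2 * \<i> * epow z (1/2) * epow \<tau> (1/8) * theta (epow z 1) (epow \<tau> 1)"
proof -
  have summand: "(-1) ^ n * epow z (real n + 1/2) * epow \<tau> ((real n + 1/2)\<^sup>2 / 2) =
      epow z (1/2) * epow \<tau> (1/8) * ((- epow z 1) ^ n * epow \<tau> 1 ^ tri n)" for n
  proof -
    have "real (2 * tri n) = real (n * (n + 1))" by (simp only: two_tri)
    hence "(real n + 1/2)\<^sup>2 / 2 = real (tri n) + 1/8"
      by (simp add: power2_eq_square field_simps)
    thus ?thesis
      by (simp only: epow_add epow_of_nat power_minus[of "epow z 1"]) (simp only: mult_ac)
  qed
  have "(\<lambda>n. epow z (1/2) * epow \<tau> (1/8) * ((- epow z 1) ^ n * epow \<tau> 1 ^ tri n)) sums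
      (epow z (1/2) * epow \<tau> (1/8) * theta (epow z 1) (epow \<tau> 1))"
    by (intro sums_mult theta_sums norm_epow_1_less_1 assms)
  thus ?thesis unfolding partial_theta_def summand by (simp add: sums_iff mult.assoc)
qed

lemma partial_theta0_eq:
  assumes "Im \<tau> > 0"
  shows "partial_theta0 \<tau> = 2 * \<i> * epow \<tau> (1/8) * theta 1 (epow \<tau> 1)"
  using partial_theta_eq[OF assms, of 0] by (simp add: partial_theta0_def)

lemma partial_theta0_eq_0_iff: "Im \<tau> > 0 \<Longrightarrow> partial_theta0 \<tau> = 0 \<longleftrightarrow> theta 1 (epow \<tau> 1) = 0"
  by (simp add: partial_theta0_eq)

text \<open>Every nonzero point of the disc is e^(2\<pi>i\<tau>') for some \<tau>' with Im \<tau>'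
  \<ge> Im \<tau>; the centre, which no \<tau>' reaches, is covered by \<theta>(1, 0) = 1.\<close>

lemma theta_nonzero_in_expansion_domain:
  assumes "in_expansion_domain \<tau>" "norm q \<le> norm (epow \<tau> 1)"
  shows "theta 1 q \<noteq> 0"
proof (cases "q = 0")
  case False
  define \<tau>' where "\<tau>' = Ln q / (2 * of_real pi * \<i>)"
  have q: "epow \<tau>' 1 = q" using False by (simp add: epow_def \<tau>'_def)
  have "exp (- 2 * pi * Im \<tau>') \<le> exp (- 2 * pi * Im \<tau>)"
    using assms(2) unfolding q[symmetric] norm_epow_1 .
  hence "Im \<tau>' \<ge> Im \<tau>" by simp
  with assms(1) have "Im \<tau>' > 0" "partial_theta0 \<tau>' \<noteq> 0" by (auto simp: in_expansion_domain_def)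
  thus ?thesis using partial_theta0_eq_0_iff q by auto
qed simp

text \<open>Near q = 0 the value of \<theta>(1, q) is close to 1, so the assertions on the domain
  are not vacuous.\<close>

lemma ex_expansion_domain: "\<exists>Y. \<forall>\<tau>. Im \<tau> \<ge> Y \<longrightarrow> in_expansion_domain \<tau>"
proof -
  have "isCont (theta 1) 0"
    using holomorphic_on_imp_continuous_on[OF theta_holomorphic[of 1]]
    by (simp add: continuous_on_eq_continuous_at)
  hence "eventually (\<lambda>q. theta 1 q \<noteq> 0) (nhds 0)"
    unfolding isCont_def by (intro tendsto_imp_eventually_ne[of "theta 1" "theta 1 0"])
      (auto simp: tendsto_nhds_iff)
  then obtain d where d: "d > 0" "\<And>q. dist q 0 < d \<Longrightarrow> theta 1 q \<noteq> 0"
    unfolding eventually_nhds_metric by blast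
  \<comment> \<open>The second entry forces |q| \<le> d e^(-2\<pi>) < d; the first keeps the
    imaginary part positive.\<close>
  define Y where "Y = max 1 (1 - ln d / (2 * pi))"
  have "in_expansion_domain \<tau>" if "Im \<tau> \<ge> Y" for \<tau>
    unfolding in_expansion_domain_def
  proof (intro conjI allI impI)
    show "Im \<tau> > 0" using that by (simp add: Y_def)
    fix \<tau>' assume "Im \<tau>' \<ge> Im \<tau>"
    hence \<tau>': "Im \<tau>' \<ge> 1 - ln d / (2 * pi)" "Im \<tau>' > 0" using that by (auto simp: Y_def)
    hence "2 * pi * Im \<tau>' \<ge> 2 * pi * (1 - ln d / (2 * pi))" by (intro mult_left_mono) auto
    also have "2 * pi * (1 - ln d / (2 * pi)) = 2 * pi - ln d" by (simp add: field_simps)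
    finally have "- 2 * pi * Im \<tau>' < ln d" using pi_gt_zero by linarith
    hence "exp (- 2 * pi * Im \<tau>') < exp (ln d)" by (simp only: exp_less_cancel_iff)
    hence "norm (epow \<tau>' 1) < d" using d(1) by (simp only: norm_epow_1 exp_ln)
    thus "partial_theta0 \<tau>' \<noteq> 0" using d(2)[of "epow \<tau>' 1"] \<tau>'(2) by (simp add: partial_theta0_eq_0_iff)
  qed
  thus ?thesis by blast
qed

text \<open>Dividing by T_0 leaves two equal exponentials near 0, and
  \<open>exp_compose_cancel\<close> compares the exponents as formal series. This ties the choice in
  \<open>partial_Eisenstein\<close> to the explicit coefficients.\<close>

lemma partial_Eisenstein_identity_unique:
  assumes c: "partial_Eisenstein_identity \<tau> c" and c': "partial_Eisenstein_identity \<tau> c'"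
    and nz: "partial_theta0 \<tau> \<noteq> 0" and k: "k \<ge> 1"
  shows "c k = c' k"
proof -
  \<comment> \<open>The identity says nothing about \<open>c 0\<close>, and composing with
    \<open>fps_exp 1\<close> calls for a vanishing constant term; hence the 0 at k = 0.\<close>
  define F where "F c = Abs_fps (\<lambda>k. if k = 0 then 0 else - c k * (2 * of_real pi * \<i>) ^ k / fact k)"
    for c :: "nat \<Rightarrow> complex"
  define h where "h c z = - (\<Sum>\<^sub>\<infinity>k\<in>{1..}. c k * (2 * of_real pi * \<i> * z) ^ k / fact k)"
    for c :: "nat \<Rightarrow> complex" and z :: complex
  have h: "h c has_fps_expansion F c" if "partial_Eisenstein_identity \<tau> c" for c
  proof (rule has_fps_expansionI)
    show "eventually (\<lambda>z. (\<lambda>k. F c $ k * z ^ k) sums h c z) (nhds 0)"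
      using that unfolding partial_Eisenstein_identity_def
    proof eventually_elim
      case (elim z)
      have "((\<lambda>k. - (c k * (2 * of_real pi * \<i> * z) ^ k / fact k)) has_sum h c z) {1..}"
        unfolding h_def by (intro has_sum_uminusI has_sum_infsum) (use elim in blast)
      also have "?this \<longleftrightarrow> ((\<lambda>k. F c $ k * z ^ k) has_sum h c z) UNIV"
        by (intro has_sum_cong_neutral) (auto simp: F_def power_mult_distrib)
      finally show ?case by (rule has_sum_imp_sums)
    qed
  qed
  have comp: "(\<lambda>z. exp (h c z)) has_fps_expansion (fps_exp 1 oo F c)"
    if "partial_Eisenstein_identity \<tau> c" for c
    using has_fps_expansion_compose[OF has_fps_expansion_exp1 h[OF that]] by (simp add: F_def o_def)
  have "eventually (\<lambda>z. exp (h c z) = exp (h c' z)) (nhds 0)"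
    using c c' unfolding partial_Eisenstein_identity_def
    by eventually_elim (use nz in \<open>simp add: h_def\<close>)
  with comp[OF c] have "(\<lambda>z. exp (h c' z)) has_fps_expansion (fps_exp 1 oo F c)"
    by (rule has_fps_expansion_cong[OF _ refl, THEN iffD1, rotated])
  from fps_expansion_unique_complex[OF this comp[OF c']]
  have "F c = F c'" by (rule exp_compose_cancel) (simp_all add: F_def)
  hence "F c $ k = F c' $ k" by simp
  thus ?thesis using k by (simp add: F_def)
qed

section \<open>The two expansions on the domain\<close>

lemma infsum_from_1: "f 0 = 0 \<Longrightarrow> infsum f {1..} = infsum f UNIV" for f :: "nat \<Rightarrow> complex"
  by (intro infsum_cong_neutral) (auto simp: not_le)

lemma has_sum_from_1:
  fixes f :: "nat \<Rightarrow> complex"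
  assumes "(f has_sum s) UNIV"
  shows "(f has_sum (s - f 0)) {1..}"
proof -
  have "(f has_sum (s - f 0)) (UNIV - {0})"
    using assms has_sum_finite[of "{0}" f] by (intro has_sum_Diff) auto
  moreover have "UNIV - {0::nat} = {1..}" by auto
  ultimately show ?thesis by simp
qed

lemma expansion_domain_expansions:
  assumes dom: "in_expansion_domain \<tau>"
  defines "q \<equiv> epow \<tau> 1"
  defines "G \<equiv> \<lambda>k. \<Sum>\<^sub>\<infinity>n\<in>{1..}. moment k n * q ^ n"
  shows "(\<lambda>n. moment k n * q ^ n) summable_on {1..}"
    and "partial_theta0 \<tau> = 2 * \<i> * epow \<tau> (1/8) * exp (- G 0)"
    and "partial_Eisenstein_identity \<tau> (\<lambda>k. - (if k = 1 then 1 else 0) / 2 + G k)"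
proof -
  have Im: "Im \<tau> > 0" using dom by (simp add: in_expansion_domain_def)
  have q: "0 < norm q" "norm q < 1" using norm_epow_1_less_1[OF Im] by (auto simp: q_def)
  have nz: "\<forall>q'. norm q' \<le> norm q \<longrightarrow> theta 1 q' \<noteq> 0"
    using theta_nonzero_in_expansion_domain[OF dom] unfolding q_def by blast
  note mom = theta_expansion(1)[OF q nz]
  obtain \<rho> where \<rho>: "\<rho> > 0"
    and "\<forall>w. norm w < \<rho> \<longrightarrow>
      (\<exists>s. ((\<lambda>k. infsum (\<lambda>n. moment k n * q ^ n) UNIV * w ^ k / fact k) has_sum s) UNIV
        \<and> theta (exp w) q = exp (- s))"
    using theta_expansion(2)[OF q nz] by (elim exE conjE)
  hence ex: "\<exists>s. ((\<lambda>k. infsum (\<lambda>n. moment k n * q ^ n) UNIV * w ^ k / fact k) has_sum s) UNIV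
        \<and> theta (exp w) q = exp (- s)" if "norm w < \<rho>" for w
    using that by blast
  have G: "G k = infsum (\<lambda>n. moment k n * q ^ n) UNIV" for k
    unfolding G_def by (intro infsum_from_1) simp
  note ex = ex[folded G]
  show "(\<lambda>n. moment k n * q ^ n) summable_on {1..}"
    by (rule summable_on_subset[OF mom]) auto
  obtain s0 where s0: "((\<lambda>k. G k * 0 ^ k / fact k) has_sum s0) UNIV" "theta 1 q = exp (- s0)"
    using ex[of 0] \<rho> by auto
  \<comment> \<open>At w = 0 only the term k = 0 survives, as 0^0 = 1.\<close>
  have "((\<lambda>k. G k * 0 ^ k / fact k) has_sum G 0) UNIV"
    by (rule has_sum_finite_neutralI[of "{0}"]) auto
  with s0 have theta1: "theta 1 q = exp (- G 0)" using has_sum_unique by blast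
  thus T0: "partial_theta0 \<tau> = 2 * \<i> * epow \<tau> (1/8) * exp (- G 0)"
    using partial_theta0_eq[OF Im] by (simp add: q_def)
  show "partial_Eisenstein_identity \<tau> (\<lambda>k. - (if k = 1 then 1 else 0) / 2 + G k)"
    unfolding partial_Eisenstein_identity_def
  proof -
    let ?c = "\<lambda>k::nat. - (if k = 1 then 1 else 0) / 2 + G k"
    have "((\<lambda>z. norm (2 * of_real pi * \<i> * z)) \<longlongrightarrow> norm (2 * of_real pi * \<i> * 0)) (nhds (0::complex))"
      by (intro tendsto_intros filterlim_ident)
    hence "eventually (\<lambda>z. norm (2 * of_real pi * \<i> * z) < \<rho>) (nhds (0::complex))"
      using \<rho> by (intro order_tendstoD) auto
    thus "\<forall>\<^sub>F z in nhds 0.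
        (\<lambda>k. ?c k * (2 * of_real pi * \<i> * z) ^ k / fact k) summable_on {1..} \<and>
        partial_theta z \<tau> = partial_theta0 \<tau> *
          exp (- (\<Sum>\<^sub>\<infinity>k\<in>{1..}. ?c k * (2 * of_real pi * \<i> * z) ^ k / fact k))"
    proof eventually_elim
      case (elim z)
      define w where "w = 2 * of_real pi * \<i> * z"
      obtain s where s: "((\<lambda>k. G k * w ^ k / fact k) has_sum s) UNIV" "theta (exp w) q = exp (- s)"
        using ex[of w] elim unfolding w_def by blast
      have "((\<lambda>k. G k * w ^ k / fact k) has_sum (s - G 0)) {1..}"
        using has_sum_from_1[OF s(1)] by simp
      \<comment> \<open>The origin of the Kronecker delta: the factor \<zeta>^(1/2) = e^(w/2), moved
        inside exp(-...), becomes the linear term -w/2.\<close>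
      moreover have "((\<lambda>k. (- (if k = 1 then 1 else 0) / 2) * w ^ k / fact k) has_sum (- w / 2)) {1..}"
        by (rule has_sum_finite_neutralI[of "{1}"]) auto
      ultimately have "((\<lambda>k. (- (if k = 1 then 1 else 0) / 2) * w ^ k / fact k + G k * w ^ k / fact k) has_sum
          (- w / 2 + (s - G 0))) {1..}" by (intro has_sum_add)
      hence sum: "((\<lambda>k. ?c k * w ^ k / fact k) has_sum (- w / 2 + (s - G 0))) {1..}"
        by (simp only: add_divide_distrib distrib_right)
      have "epow z (1/2) = exp (w / 2)" "epow z 1 = exp w" by (simp_all add: epow_def w_def mult_ac)
      hence "partial_theta z \<tau> = 2 * \<i> * epow \<tau> (1/8) * (exp (w / 2) * exp (- s))"
        using partial_theta_eq[OF Im, of z] s(2) by (simp add: q_def mult_ac)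
      \<comment> \<open>\<open>G 0\<close> is the term that the sum from k = 1 omits; its
        exponential is absorbed into T_0.\<close>
      also have "exp (w / 2) * exp (- s) = exp (- G 0) * exp (- (- w / 2 + (s - G 0)))"
        by (simp flip: exp_add)
      also have "2 * \<i> * epow \<tau> (1/8) * \<dots> = partial_theta0 \<tau> * exp (- (- w / 2 + (s - G 0)))"
        by (simp add: T0)
      finally show ?case
        using sum unfolding w_def[symmetric] by (auto simp: infsumI has_sum_imp_summable)
    qed
  qed
qed

theorem theorem1p5:
  shows
    "(\<exists>Y. \<forall>\<tau>. Im \<tau> \<ge> Y \<longrightarrow> in_expansion_domain \<tau>) \<and>
     (\<forall>\<tau>. in_expansion_domain \<tau> \<longrightarrow>
        (\<exists>c. partial_Eisenstein_identity \<tau> c) \<and>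
        (\<forall>k\<ge>1.
           (\<lambda>n. (\<Sum>m=1..n. of_real (a_coeff n m) * of_nat m ^ (k - 1)) * epow \<tau> (real n))
             summable_on {1..} \<and>
           partial_Eisenstein k \<tau> =
             - (if k = 1 then 1 else 0) / 2 +
             (\<Sum>\<^sub>\<infinity>n\<in>{1..}.
                (\<Sum>m=1..n. of_real (a_coeff n m) * of_nat m ^ (k - 1)) * epow \<tau> (real n))) \<and>
        (\<lambda>n. (\<Sum>m=1..n. of_real (a_coeff n m) / of_nat m) * epow \<tau> (real n))
          summable_on {1..} \<and>
        partial_theta0 \<tau> =
          2 * \<i> * epow \<tau> (1/8) *
          exp (- (\<Sum>\<^sub>\<infinity>n\<in>{1..}.
                    (\<Sum>m=1..n. of_real (a_coeff n m) / of_nat m) * epow \<tau> (real n)))) \<and>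
     (\<forall>n\<ge>1. \<forall>m\<in>{1..n}.
        a_coeff n m \<in> \<int> \<and>
        (int m < \<lceil>(sqrt (8 * real n + 1) - 1) / 2\<rceil> \<longrightarrow> a_coeff n m = 0))"
proof (intro conjI allI impI ballI)
  fix \<tau> assume dom: "in_expansion_domain \<tau>"
  note exps = expansion_domain_expansions[OF dom]
  show "\<exists>c. partial_Eisenstein_identity \<tau> c" using exps(3) by blast
  show "(\<lambda>n. (\<Sum>m=1..n. of_real (a_coeff n m) / of_nat m) * epow \<tau> (real n)) summable_on {1..}"
    using exps(1)[of 0] unfolding moment_zeroth epow_of_nat .
  show "partial_theta0 \<tau> = 2 * \<i> * epow \<tau> (1/8) *
          exp (- (\<Sum>\<^sub>\<infinity>n\<in>{1..}. (\<Sum>m=1..n. of_real (a_coeff n m) / of_nat m) * epow \<tau> (real n)))"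
    using exps(2) unfolding moment_zeroth epow_of_nat .
  fix k :: nat assume k: "k \<ge> 1"
  show "(\<lambda>n. (\<Sum>m=1..n. of_real (a_coeff n m) * of_nat m ^ (k - 1)) * epow \<tau> (real n)) summable_on {1..}"
    using exps(1)[of k] unfolding moment_pos[OF k] epow_of_nat .
  have "partial_Eisenstein_identity \<tau> (SOME c. partial_Eisenstein_identity \<tau> c)"
    by (rule someI[of "partial_Eisenstein_identity \<tau>", OF exps(3)])
  \<comment> \<open>The product formula shows that T_0 does not vanish, which uniqueness
    requires.\<close>
  moreover have "partial_theta0 \<tau> \<noteq> 0" using exps(2) by simp
  ultimately have "partial_Eisenstein k \<tau> =
      - (if k = 1 then 1 else 0) / 2 + (\<Sum>\<^sub>\<infinity>n\<in>{1..}. moment k n * epow \<tau> 1 ^ n)"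
    unfolding partial_Eisenstein_def using partial_Eisenstein_identity_unique[OF _ exps(3) _ k] by blast
  thus "partial_Eisenstein k \<tau> = - (if k = 1 then 1 else 0) / 2 +
      (\<Sum>\<^sub>\<infinity>n\<in>{1..}. (\<Sum>m=1..n. of_real (a_coeff n m) * of_nat m ^ (k - 1)) * epow \<tau> (real n))"
    unfolding moment_pos[OF k] epow_of_nat .
qed (use ex_expansion_domain a_coeff_int a_coeff_0 in auto)

end
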